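(* Let $\mathfrak g$ be a finite-dimensional real Lie algebra that admits a $\mathfrak g$-invariant (positive definite) inner product, and let $\mathfrak h\subset\mathfrak g$ be a Lie subalgebra of even codimension. (i) Let $J$ be an $\mathfrak h$-invariant integrable complex structure on $\mathfrak g/\mathfrak h$, and let $$\mathfrak m=\{x\in N_{\mathfrak g}(\mathfrak h)\mid [\overline{ad}(x),J]=0\}.$$ Then $\mathfrak m$ is the centralizer in $\mathfrak g$ of an abelian subalgebra of $\mathfrak g$, and $[\mathfrak m,\mathfrak m]=[\mathfrak h,\mathfrak h]$. Additionally, $\mathfrak h\subset\mathfrak m$. (ii) If there exists an abelian subalgebra $\mathfrak t$ of $\mathfrak g$ whose centralizer $\mathfrak m$ in $\mathfrak g$ satisfies $[\mathfrak m,\mathfrak m]=[\mathfrak h,\mathfrak h]$, then there exists an $\mathfrak h$-invariant complex structure $J$ on $\mathfrak g/\mathfrak h$ such that $N=0$ (that is, $J$ is integrable).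
   Context: $N_{\mathfrak g}(\mathfrak h)=\{x\in\mathfrak g\mid [x,\mathfrak h]\subset\mathfrak h\}$ is the normalizer of $\mathfrak h$ in $\mathfrak g$. For $x\in N_{\mathfrak g}(\mathfrak h)$, $\overline{ad}(x)$ is the endomorphism of $\mathfrak g/\mathfrak h$ induced by $ad(x)y=[x,y]$. Let $\pi:\mathfrak g\to\mathfrak g/\mathfrak h$ be the natural surjection. An $\mathfrak h$-invariant complex structure on $\mathfrak g/\mathfrak h$ is a real-linear $J\in\mathrm{End}(\mathfrak g/\mathfrak h)$ with $J^2=-\mathrm{id}$ and $[J,\overline{ad}(x)]=0$ for all $x\in\mathfrak h$. For such $J$ define the bilinear map $N:\mathfrak g/\mathfrak h\times\mathfrak g/\mathfrak h\to\mathfrak g/\mathfrak h$ by $$N(u,v)=\pi[x,y]+J(\pi[x',y]+\pi[x,y'])-\pi[x',y'],$$ where $x,y,x',y'\in\mathfrak g$ are any elements with $\pi(x)=u$, $\pi(y)=v$, $\pi(x')=Ju$, $\pi(y')=Jv$ (the value is independent of the choices). $J$ is called integrable if $N=0$. *)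

theory Defs
  imports "HOL-Analysis.Analysis"
begin

(* The Lie algebra is the whole type 'g; its bracket br is a parameter of all definitions. *)
locale lie_algebra =
  fixes br :: "'g::real_vector \<Rightarrow> 'g \<Rightarrow> 'g"
  assumes bilinear_br: "bilinear br"
    and br_self: "br x x = 0"
    and jacobi: "br x (br y z) + br y (br z x) + br z (br x y) = 0"

(* Replaces the library class euclidean_space, which excludes the zero space and carries an
   inner product unrelated to the bracket. *)
definition finite_dimensional :: "'g::real_vector itself \<Rightarrow> bool" where
  "finite_dimensional _ \<longleftrightarrow> (\<exists>B :: 'g set. finite B \<and> span B = UNIV)"

definition invariant_inner_product ::
    "('g::real_vector \<Rightarrow> 'g \<Rightarrow> 'g) \<Rightarrow> ('g \<Rightarrow> 'g \<Rightarrow> real) \<Rightarrow> bool" where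
  "invariant_inner_product br ip \<longleftrightarrow>
     bilinear ip \<and> (\<forall>x y. ip x y = ip y x) \<and> (\<forall>x. x \<noteq> 0 \<longrightarrow> ip x x > 0) \<and>
     (\<forall>x y z. ip (br x y) z + ip y (br x z) = 0)"

definition lie_subalgebra :: "('g::real_vector \<Rightarrow> 'g \<Rightarrow> 'g) \<Rightarrow> 'g set \<Rightarrow> bool" where
  "lie_subalgebra br h \<longleftrightarrow> subspace h \<and> (\<forall>x\<in>h. \<forall>y\<in>h. br x y \<in> h)"

definition abelian_subalgebra :: "('g::real_vector \<Rightarrow> 'g \<Rightarrow> 'g) \<Rightarrow> 'g set \<Rightarrow> bool" where
  "abelian_subalgebra br t \<longleftrightarrow> lie_subalgebra br t \<and> (\<forall>x\<in>t. \<forall>y\<in>t. br x y = 0)"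

definition lie_centralizer :: "('g::real_vector \<Rightarrow> 'g \<Rightarrow> 'g) \<Rightarrow> 'g set \<Rightarrow> 'g set" where
  "lie_centralizer br t = {x. \<forall>y\<in>t. br x y = 0}"

definition lie_normalizer :: "('g::real_vector \<Rightarrow> 'g \<Rightarrow> 'g) \<Rightarrow> 'g set \<Rightarrow> 'g set" where
  "lie_normalizer br h = {x. \<forall>y\<in>h. br x y \<in> h}"

definition derived_subalgebra :: "('g::real_vector \<Rightarrow> 'g \<Rightarrow> 'g) \<Rightarrow> 'g set \<Rightarrow> 'g set" where
  "derived_subalgebra br m = span {br x y | x y. x \<in> m \<and> y \<in> m}"

(* The quotient of 'g by a subspace h consists of the cosets of h, and its zero is h itself.
   Its operations are given as unions over all representatives, as is customary in the
   library theory Equiv_Relations; when the value does not depend on the representatives,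
   this union is the single coset in question. *)
definition qproj :: "'g::real_vector set \<Rightarrow> 'g \<Rightarrow> 'g set" where
  "qproj h x = (+) x ` h"

definition quot :: "'g::real_vector set \<Rightarrow> 'g set set" where
  "quot h = range (qproj h)"

definition qadd :: "'g::real_vector set \<Rightarrow> 'g set \<Rightarrow> 'g set \<Rightarrow> 'g set" where
  "qadd h U V = (\<Union>x\<in>U. \<Union>y\<in>V. qproj h (x + y))"

definition qlift :: "'g::real_vector set \<Rightarrow> ('g \<Rightarrow> 'g) \<Rightarrow> 'g set \<Rightarrow> 'g set" where
  "qlift h f U = (\<Union>x\<in>U. qproj h (f x))"

definition qscale :: "'g::real_vector set \<Rightarrow> real \<Rightarrow> 'g set \<Rightarrow> 'g set" where
  "qscale h c = qlift h (\<lambda>x. c *\<^sub>R x)"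

definition quminus :: "'g::real_vector set \<Rightarrow> 'g set \<Rightarrow> 'g set" where
  "quminus h = qlift h uminus"

definition qdiff :: "'g::real_vector set \<Rightarrow> 'g set \<Rightarrow> 'g set \<Rightarrow> 'g set" where
  "qdiff h U V = qadd h U (quminus h V)"

(* Real-linear endomorphisms of the quotient; values outside quot h are irrelevant. *)
definition qlinear :: "'g::real_vector set \<Rightarrow> ('g set \<Rightarrow> 'g set) \<Rightarrow> bool" where
  "qlinear h J \<longleftrightarrow>
     (\<forall>U\<in>quot h. J U \<in> quot h) \<and>
     (\<forall>U\<in>quot h. \<forall>V\<in>quot h. J (qadd h U V) = qadd h (J U) (J V)) \<and>
     (\<forall>c. \<forall>U\<in>quot h. J (qscale h c U) = qscale h c (J U))"

definition qcommute :: "'g::real_vector set \<Rightarrow> ('g set \<Rightarrow> 'g set) \<Rightarrow> ('g set \<Rightarrow> 'g set) \<Rightarrow> bool" where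
  "qcommute h A B \<longleftrightarrow> (\<forall>U\<in>quot h. qdiff h (A (B U)) (B (A U)) = h)"

(* Meaningful for x in the normalizer of h. *)
definition ad_bar :: "('g::real_vector \<Rightarrow> 'g \<Rightarrow> 'g) \<Rightarrow> 'g set \<Rightarrow> 'g \<Rightarrow> 'g set \<Rightarrow> 'g set" where
  "ad_bar br h x = qlift h (br x)"

definition invariant_complex_structure ::
    "('g::real_vector \<Rightarrow> 'g \<Rightarrow> 'g) \<Rightarrow> 'g set \<Rightarrow> ('g set \<Rightarrow> 'g set) \<Rightarrow> bool" where
  "invariant_complex_structure br h J \<longleftrightarrow>
     qlinear h J \<and> (\<forall>U\<in>quot h. J (J U) = quminus h U) \<and>
     (\<forall>x\<in>h. qcommute h J (ad_bar br h x))"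

(* One value of N, for chosen representatives x, y, x', y' of U, V, J U, J V. *)
definition nijenhuis_rep ::
    "('g::real_vector \<Rightarrow> 'g \<Rightarrow> 'g) \<Rightarrow> 'g set \<Rightarrow> ('g set \<Rightarrow> 'g set) \<Rightarrow> 'g \<Rightarrow> 'g \<Rightarrow> 'g \<Rightarrow> 'g \<Rightarrow> 'g set" where
  "nijenhuis_rep br h J x y x' y' =
     qdiff h
       (qadd h (qproj h (br x y)) (J (qadd h (qproj h (br x' y)) (qproj h (br x y')))))
       (qproj h (br x' y'))"

definition nijenhuis ::
    "('g::real_vector \<Rightarrow> 'g \<Rightarrow> 'g) \<Rightarrow> 'g set \<Rightarrow> ('g set \<Rightarrow> 'g set) \<Rightarrow> 'g set \<Rightarrow> 'g set \<Rightarrow> 'g set" where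
  "nijenhuis br h J U V =
     (\<Union>x\<in>U. \<Union>y\<in>V. \<Union>x'\<in>J U. \<Union>y'\<in>J V. nijenhuis_rep br h J x y x' y')"

definition integrable_structure ::
    "('g::real_vector \<Rightarrow> 'g \<Rightarrow> 'g) \<Rightarrow> 'g set \<Rightarrow> ('g set \<Rightarrow> 'g set) \<Rightarrow> bool" where
  "integrable_structure br h J \<longleftrightarrow> (\<forall>U\<in>quot h. \<forall>V\<in>quot h. nijenhuis br h J U V = h)"

(* Well-definedness of the operations above. *)

lemma qproj_eq_iff:
  assumes "subspace h"
  shows "qproj h x = qproj h y \<longleftrightarrow> x - y \<in> h"
proof
  assume "qproj h x = qproj h y"
  moreover have "x \<in> qproj h x"
    unfolding qproj_def using subspace_0[OF assms] by force
  ultimately show "x - y \<in> h" unfolding qproj_def by auto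
next
  assume d: "x - y \<in> h"
  have "x + a \<in> qproj h y" if "a \<in> h" for a
    unfolding qproj_def using subspace_add[OF assms d that]
    by (intro image_eqI[of _ _ "x - y + a"]) auto
  moreover have "y + a \<in> qproj h x" if "a \<in> h" for a
    unfolding qproj_def using subspace_diff[OF assms that d]
    by (intro image_eqI[of _ _ "a - (x - y)"]) auto
  ultimately show "qproj h x = qproj h y" unfolding qproj_def by blast
qed

lemma qproj_self: "subspace h \<Longrightarrow> x \<in> qproj h x"
  unfolding qproj_def using subspace_0 by force

lemma in_qproj_iff: "subspace h \<Longrightarrow> y \<in> qproj h x \<longleftrightarrow> qproj h y = qproj h x"
  unfolding qproj_eq_iff unfolding qproj_def
  by (auto simp: image_iff) (metis add_diff_cancel_left' add.commute diff_add_cancel)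

lemma qproj_0: "qproj h 0 = h"
  unfolding qproj_def by simp

lemma qlift_qproj:
  assumes "subspace h" "\<And>x y. x - y \<in> h \<Longrightarrow> f x - f y \<in> h"
  shows "qlift h f (qproj h x) = qproj h (f x)"
proof -
  have "qproj h (f y) = qproj h (f x)" if "y \<in> qproj h x" for y
    using that assms by (simp add: in_qproj_iff qproj_eq_iff)
  then show ?thesis unfolding qlift_def using qproj_self[OF assms(1), of x] by blast
qed

lemma qadd_qproj:
  assumes "subspace h"
  shows "qadd h (qproj h x) (qproj h y) = qproj h (x + y)"
proof -
  have "qproj h (a + b) = qproj h (x + y)" if "a \<in> qproj h x" "b \<in> qproj h y" for a b
    using that assms subspace_add[OF assms, of "a - x" "b - y"]
    by (simp add: in_qproj_iff qproj_eq_iff algebra_simps)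
  then show ?thesis
    unfolding qadd_def using qproj_self[OF assms, of x] qproj_self[OF assms, of y] by blast
qed

lemma qscale_qproj: "subspace h \<Longrightarrow> qscale h c (qproj h x) = qproj h (c *\<^sub>R x)"
  unfolding qscale_def by (rule qlift_qproj) (auto simp flip: scaleR_diff_right intro: subspace_scale)

lemma quminus_qproj: "subspace h \<Longrightarrow> quminus h (qproj h x) = qproj h (- x)"
  unfolding quminus_def
  by (rule qlift_qproj) (auto dest: subspace_neg simp: algebra_simps)

lemma qdiff_qproj: "subspace h \<Longrightarrow> qdiff h (qproj h x) (qproj h y) = qproj h (x - y)"
  unfolding qdiff_def by (simp add: quminus_qproj qadd_qproj)

lemma qcommute_iff:
  assumes "subspace h" "\<And>U. U \<in> quot h \<Longrightarrow> A U \<in> quot h" "\<And>U. U \<in> quot h \<Longrightarrow> B U \<in> quot h"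
  shows "qcommute h A B \<longleftrightarrow> (\<forall>U\<in>quot h. A (B U) = B (A U))"
proof -
  have "qdiff h P Q = h \<longleftrightarrow> P = Q" if PQ: "P \<in> quot h" "Q \<in> quot h" for P Q
  proof -
    obtain p q where pq: "P = qproj h p" "Q = qproj h q"
      using PQ unfolding quot_def by blast
    have "qproj h (p - q) = h \<longleftrightarrow> p - q \<in> h"
      using qproj_eq_iff[OF assms(1), of "p - q" 0] by (simp add: qproj_0)
    then show ?thesis
      by (simp add: pq qdiff_qproj[OF assms(1)] qproj_eq_iff[OF assms(1)])
  qed
  then show ?thesis unfolding qcommute_def using assms(2,3) by (intro ball_cong) auto
qed

lemma (in lie_algebra) ad_bar_qproj:
  assumes "subspace h" "x \<in> lie_normalizer br h"
  shows "ad_bar br h x (qproj h y) = qproj h (br x y)"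
  unfolding ad_bar_def using assms
  by (intro qlift_qproj) (auto simp: lie_normalizer_def simp flip: bilinear_rsub[OF bilinear_br])

lemma (in lie_algebra) br_commute: "br x y = - br y x"
proof -
  have "br x y + br y x = br (x + y) (x + y)"
    unfolding bilinear_ladd[OF bilinear_br] bilinear_radd[OF bilinear_br]
    by (simp add: br_self[of x] br_self[of y])
  also have "\<dots> = 0" by (rule br_self)
  finally have "br x y + br y x = 0" .
  then show ?thesis by (simp only: eq_neg_iff_add_eq_0)
qed

lemma (in lie_algebra) nijenhuis_rep_cong_left:
  assumes h: "lie_subalgebra br h" and J: "invariant_complex_structure br h J"
    and x: "qproj h x1 = qproj h x" and x': "qproj h x1' = qproj h x'"
    and Jy: "J (qproj h y) = qproj h y'"
  shows "nijenhuis_rep br h J x1 y x1' y' = nijenhuis_rep br h J x y x' y'"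
proof -
  have sub: "subspace h" using h by (simp add: lie_subalgebra_def)
  note pr = qadd_qproj[OF sub] qdiff_qproj[OF sub] quminus_qproj[OF sub]
  note bl = bilinear_ladd[OF bilinear_br] bilinear_radd[OF bilinear_br]
  have lin: "qlinear h J"
    and sq: "\<And>z. J (J (qproj h z)) = qproj h (- z)"
    and com: "\<And>a. a \<in> h \<Longrightarrow> qcommute h J (ad_bar br h a)"
    using J pr by (auto simp: invariant_complex_structure_def quot_def)
  have Jadd: "J (qproj h (p + q)) = qadd h (J (qproj h p)) (J (qproj h q))" for p q
    using lin unfolding qlinear_def quot_def by (auto simp flip: pr)
  have "\<exists>j. J (qproj h p) = qproj h j" for p
    using lin unfolding qlinear_def quot_def by blast
  then obtain j where j: "\<And>p. J (qproj h p) = qproj h (j p)" by metis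
  have jadd: "qproj h (j (p + q)) = qproj h (j p + j q)" for p q
    using Jadd[of p q] by (simp add: j pr)
  have norm: "a \<in> lie_normalizer br h" if "a \<in> h" for a
    using that h by (auto simp: lie_normalizer_def lie_subalgebra_def)
  have ad: "qproj h (j (br a z)) = qproj h (br a (j z))" if a: "a \<in> h" for a z
  proof -
    have "J (ad_bar br h a (qproj h z)) = ad_bar br h a (J (qproj h z))"
      using com[OF a] lin qcommute_iff[OF sub, of J "ad_bar br h a"]
        ad_bar_qproj[OF sub norm[OF a]]
      by (auto simp: qlinear_def quot_def)
    then show ?thesis using ad_bar_qproj[OF sub norm[OF a]] by (simp add: j)
  qed
  have jy: "qproj h y' = qproj h (j y)" using Jy j by simp
  have jy': "qproj h (j y') = qproj h (- y)" using sq[of y] Jy j[of y'] by metis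
  have bc: "qproj h (br a p) = qproj h (br a q)" if "a \<in> h" "qproj h p = qproj h q" for a p q
    using ad_bar_qproj[OF sub norm[OF that(1)]] that(2) by metis
  define a b where "a = x1 - x" and "b = x1' - x'"
  have ab: "a \<in> h" "b \<in> h"
    using x x' sub by (auto simp: a_def b_def qproj_eq_iff)
  have x1: "x1 = x + a" "x1' = x' + b" by (auto simp: a_def b_def)
  have e1: "qproj h (j (br a y')) = qproj h (- br a y)"
    using ad[OF ab(1), of y'] bc[OF ab(1) jy'] by (simp add: bilinear_rneg[OF bilinear_br])
  have e2: "qproj h (j (br b y)) = qproj h (br b y')"
    using ad[OF ab(2), of y] bc[OF ab(2) jy] by simp
  let ?w = "br x' y + br x y'"
  have "qproj h (j ((br x' y + br b y) + (br x y' + br a y')))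
      = qproj h (j (?w + (br b y + br a y')))"
    by (simp add: algebra_simps)
  also have "\<dots> = qadd h (qproj h (j ?w)) (qadd h (qproj h (j (br b y))) (qproj h (j (br a y'))))"
    using jadd[of ?w "br b y + br a y'"] jadd[of "br b y" "br a y'"] by (metis pr(1))
  also have "\<dots> = qproj h (j ?w + (br b y' - br a y))"
    by (simp add: e1 e2 pr)
  finally have w: "qproj h (j ((br x' y + br b y) + (br x y' + br a y')))
      = qproj h (j ?w + (br b y' - br a y))" .
  have "nijenhuis_rep br h J x1 y x1' y' =
      qdiff h (qadd h (qproj h (br x y + br a y))
        (qproj h (j ((br x' y + br b y) + (br x y' + br a y'))))) (qproj h (br x' y' + br b y'))"
    unfolding nijenhuis_rep_def x1 by (simp add: bl pr(1) j)
  also have "\<dots> = qproj h (br x y + j ?w - br x' y')"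
    unfolding w by (simp add: pr algebra_simps)
  also have "\<dots> = nijenhuis_rep br h J x y x' y'"
    unfolding nijenhuis_rep_def by (simp add: pr j)
  finally show ?thesis .
qed

lemma (in lie_algebra) nijenhuis_rep_swap:
  assumes h: "lie_subalgebra br h" and J: "invariant_complex_structure br h J"
  shows "nijenhuis_rep br h J x y x' y' = quminus h (nijenhuis_rep br h J y x y' x')"
proof -
  have sub: "subspace h" using h by (simp add: lie_subalgebra_def)
  note pr = qadd_qproj[OF sub] qdiff_qproj[OF sub] quminus_qproj[OF sub]
  have lin: "qlinear h J" using J by (simp add: invariant_complex_structure_def)
  have "\<exists>j. J (qproj h p) = qproj h j" for p
    using lin unfolding qlinear_def quot_def by blast
  then obtain j where j: "\<And>p. J (qproj h p) = qproj h (j p)" by metis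
  have "J (qscale h (-1) (qproj h p)) = qscale h (-1) (J (qproj h p))" for p
    using lin unfolding qlinear_def quot_def by blast
  then have jneg: "qproj h (j (- p)) = qproj h (- j p)" for p
    by (simp add: qscale_qproj[OF sub] j)
  let ?w = "br y' x + br y x'"
  have w: "br x' y + br x y' = - ?w"
    using br_commute[of x' y] br_commute[of x y'] by simp
  have "nijenhuis_rep br h J x y x' y'
      = qdiff h (qadd h (qproj h (br x y)) (qproj h (j (br x' y + br x y')))) (qproj h (br x' y'))"
    unfolding nijenhuis_rep_def by (simp add: pr(1) j)
  also have "\<dots> = qproj h (br x y - j ?w - br x' y')"
    unfolding w jneg by (simp add: pr)
  also have "\<dots> = qproj h (- (br y x + j ?w - br y' x'))"
    using br_commute[of x y] br_commute[of x' y'] by (simp add: algebra_simps)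
  also have "\<dots> = quminus h (nijenhuis_rep br h J y x y' x')"
    unfolding nijenhuis_rep_def by (simp add: pr j)
  finally show ?thesis .
qed

lemma (in lie_algebra) nijenhuis_eq:
  assumes h: "lie_subalgebra br h" and J: "invariant_complex_structure br h J"
    and x': "qproj h x' = J (qproj h x)" and y': "qproj h y' = J (qproj h y)"
  shows "nijenhuis br h J (qproj h x) (qproj h y) = nijenhuis_rep br h J x y x' y'"
proof -
  have sub: "subspace h" using h by (simp add: lie_subalgebra_def)
  have *: "nijenhuis_rep br h J x1 y1 x1' y1' = nijenhuis_rep br h J x y x' y'"
    if "x1 \<in> qproj h x" "y1 \<in> qproj h y" "x1' \<in> J (qproj h x)" "y1' \<in> J (qproj h y)"
    for x1 y1 x1' y1'
  proof -
    have eq: "qproj h x1 = qproj h x" "qproj h y1 = qproj h y"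
        "qproj h x1' = qproj h x'" "qproj h y1' = qproj h y'"
      using that by (simp_all add: in_qproj_iff[OF sub] flip: x' y')
    have "nijenhuis_rep br h J x1 y1 x1' y1' = nijenhuis_rep br h J x y1 x' y1'"
      by (rule nijenhuis_rep_cong_left[OF h J]) (simp_all add: eq y')
    also have "\<dots> = quminus h (nijenhuis_rep br h J y1 x y1' x')"
      by (rule nijenhuis_rep_swap[OF h J])
    also have "nijenhuis_rep br h J y1 x y1' x' = nijenhuis_rep br h J y x y' x'"
      by (rule nijenhuis_rep_cong_left[OF h J]) (simp_all add: eq x')
    also have "quminus h \<dots> = nijenhuis_rep br h J x y x' y'"
      by (rule nijenhuis_rep_swap[OF h J, symmetric])
    finally show ?thesis .
  qed
  have mem: "x \<in> qproj h x" "y \<in> qproj h y" "x' \<in> J (qproj h x)" "y' \<in> J (qproj h y)"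
    using qproj_self[OF sub] x' y' by metis+
  show ?thesis unfolding nijenhuis_def
  proof (intro equalityI subsetI)
    fix z assume "z \<in> (\<Union>x1\<in>qproj h x. \<Union>y1\<in>qproj h y. \<Union>x1'\<in>J (qproj h x).
        \<Union>y1'\<in>J (qproj h y). nijenhuis_rep br h J x1 y1 x1' y1')"
    then obtain x1 y1 x1' y1' where "x1 \<in> qproj h x" "y1 \<in> qproj h y" "x1' \<in> J (qproj h x)"
        "y1' \<in> J (qproj h y)" "z \<in> nijenhuis_rep br h J x1 y1 x1' y1'" by blast
    with * show "z \<in> nijenhuis_rep br h J x y x' y'" by metis
  next
    fix z assume "z \<in> nijenhuis_rep br h J x y x' y'"
    with mem show "z \<in> (\<Union>x1\<in>qproj h x. \<Union>y1\<in>qproj h y. \<Union>x1'\<in>J (qproj h x).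
        \<Union>y1'\<in>J (qproj h y). nijenhuis_rep br h J x1 y1 x1' y1')" by blast
  qed
qed

end

theory Submission
  imports Defs
begin

text \<open>
  Write \<open>g\<close> for the Lie algebra, \<open>h\<close> for the subalgebra and \<open>\<pi>\<close> for the projection onto
  \<open>g/h\<close>. The proof uses no root systems and no Lie groups beyond one-parameter groups of
  automorphisms.

  \<^bold>\<open>From \<open>J\<close> to a centralizer.\<close> In the complexification of \<open>g\<close>, realised as \<open>g \<times> g\<close>, let \<open>q\<close> be
  the set of all \<open>x + i y\<close> with \<open>J (\<pi> x) = \<pi> y\<close>. That \<open>J\<close> is an invariant complex structure with
  \<open>N = 0\<close> means that \<open>q\<close> is a complex subalgebra, and the set \<open>m\<close> of the theorem consists of
  the real elements that normalize \<open>q\<close>. Let \<open>tr a\<close> be the trace of the compression of \<open>ad a\<close> to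
  \<open>q\<close>; up to normalization this is the moment map of the line spanned by the top exterior power of
  \<open>q\<close>, evaluated at that line. It vanishes on real elements, and its values on imaginary ones are
  the inner products with a vector \<open>z\<close>. Now \<open>m\<close> is the centralizer of \<open>z\<close>. Indeed \<open>tr\<close>
  vanishes on commutators of elements normalizing \<open>q\<close>, which shows that \<open>m\<close> commutes with \<open>z\<close>.
  Conversely, for \<open>a = x + i y\<close> in \<open>q\<close> the number \<open>tr [a, a']\<close>, where \<open>a'\<close> is the conjugate of
  \<open>a\<close>, is minus the squared norm of the part of \<open>ad a'\<close> that leads out of \<open>q\<close>. As
  \<open>[a, a'] = - 2 i [x, y]\<close>, this number is zero if \<open>x\<close> commutes with \<open>z\<close>; then \<open>a'\<close>, and with it
  \<open>x\<close>, normalizes \<open>q\<close>. These two facts are \<open>trace_commutator\<close> and \<open>adjoint_stable_if_trace_0\<close>;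
  they are put together in \<open>m_is_centralizer_of_vector\<close>.

  On the orthogonal complement of \<open>h\<close> in \<open>m\<close>, which is an ideal of \<open>m\<close>, the bracket is complex
  bilinear for \<open>J\<close>. An invariant inner product forces such a Lie algebra to be abelian
  (\<open>complement_abelian\<close>), whence \<open>[m, m] = [h, h]\<close>.

  \<^bold>\<open>From a centralizer to \<open>J\<close>.\<close> Let \<open>s = [h, h] = [m, m]\<close>, where \<open>m\<close> is the centralizer of the
  abelian subalgebra \<open>t\<close>; it is the centralizer of a single generic \<open>z \<in> t\<close>
  (\<open>generic_element\<close>). The subalgebra \<open>h\<close> is the sum of \<open>s\<close> and of its central part, but that
  central part may lie outside \<open>m\<close>. This is repaired by moving \<open>z\<close>: if \<open>a\<close> is generic in the
  central part, choose among the isometric automorphisms \<open>T\<close> of \<open>g\<close> that fix \<open>s\<close> pointwise one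
  that maximizes the inner product of \<open>T z\<close> and \<open>a\<close>. At the maximum the derivative along
  one-parameter groups vanishes, and this says that \<open>T z\<close> and \<open>a\<close> commute
  (\<open>conjugate_to_commute\<close>). Hence the centralizer of \<open>T z\<close> contains \<open>h\<close>, and its derived algebra is
  \<open>T s = s\<close>.

  So assume that \<open>h\<close> is contained in the centralizer \<open>m\<close> of \<open>z\<close>, with \<open>[m, m] \<subseteq> h\<close>. On the
  orthogonal complement of \<open>m\<close> let \<open>J\<close> be the orthogonal factor in the polar decomposition of
  \<open>ad z\<close>; its eigenspace for one eigenvalue is the sum of the eigenspaces of \<open>ad z\<close> with
  eigenvalues on one half of the imaginary axis, which is closed under brackets (\<open>ad_polar\<close>).
  This also makes the complement of \<open>m\<close> even-dimensional, so \<open>m/h\<close> is even-dimensional and carries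
  some complex structure. Any will do, because \<open>m\<close> acts trivially on \<open>m/h\<close>.
\<close>

section \<open>Inner products on finite-dimensional spaces\<close>

text \<open>
  The type carries neither a norm nor a topology; orthogonality always refers to the form \<open>ip\<close>.
\<close>

locale inner_space =
  fixes ip :: "'a::real_vector \<Rightarrow> 'a \<Rightarrow> real"
  assumes ip_bilinear: "bilinear ip"
    and ip_sym: "ip x y = ip y x"
    and ip_pos: "x \<noteq> 0 \<Longrightarrow> ip x x > 0"
    and findim: "finite_dimensional TYPE('a)"
begin

lemmas ip_simps = bilinear_ladd[OF ip_bilinear] bilinear_radd[OF ip_bilinear]
  bilinear_lmul[OF ip_bilinear, simplified] bilinear_rmul[OF ip_bilinear, simplified]
  bilinear_lneg[OF ip_bilinear] bilinear_rneg[OF ip_bilinear]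
  bilinear_lsub[OF ip_bilinear] bilinear_rsub[OF ip_bilinear]
  bilinear_lzero[OF ip_bilinear] bilinear_rzero[OF ip_bilinear]

lemma ip_sum_left: "ip (sum f A) y = (\<Sum>a\<in>A. ip (f a) y)"
  using linear_sum[of "\<lambda>x. ip x y" f A] ip_bilinear by (simp add: bilinear_def)

lemma ip_sum_right: "ip y (sum f A) = (\<Sum>a\<in>A. ip y (f a))"
  using linear_sum[of "\<lambda>x. ip y x" f A] ip_bilinear by (simp add: bilinear_def)

lemma ip_nonneg: "ip x x \<ge> 0"
  using ip_pos[of x] by (cases "x = 0") (auto simp: ip_simps)

lemma ip_eq_0_iff [simp]: "ip x x = 0 \<longleftrightarrow> x = 0"
  using ip_pos[of x] by (cases "x = 0") (auto simp: ip_simps)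

lemma ip_all_0: "(\<And>y. ip x y = 0) \<Longrightarrow> x = 0"
  using ip_eq_0_iff by blast

lemma ip_ext: "(\<And>y. ip x y = ip x' y) \<Longrightarrow> x = x'"
  using ip_all_0[of "x - x'"] by (simp add: ip_simps)

lemma ip_normalized: "v \<noteq> 0 \<Longrightarrow> ip ((1 / sqrt (ip v v)) *\<^sub>R v) ((1 / sqrt (ip v v)) *\<^sub>R v) = 1"
  using ip_pos[of v] by (simp add: ip_simps flip: real_sqrt_mult)

definition orthonormal :: "'a set \<Rightarrow> bool" where
  "orthonormal E \<longleftrightarrow> (\<forall>x\<in>E. \<forall>y\<in>E. ip x y = (if x = y then 1 else 0))"

definition perp :: "'a set \<Rightarrow> 'a set" where
  "perp U = {x. \<forall>y\<in>U. ip x y = 0}"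

definition proj :: "'a set \<Rightarrow> 'a \<Rightarrow> 'a" where
  "proj E x = (\<Sum>e\<in>E. ip x e *\<^sub>R e)"

lemma subspace_perp: "subspace (perp U)"
  by (auto simp: perp_def subspace_def ip_simps)

lemma orthogonal_independent:
  assumes ort: "\<And>x y. x \<in> E \<Longrightarrow> y \<in> E \<Longrightarrow> x \<noteq> y \<Longrightarrow> ip x y = 0" and "0 \<notin> E"
  shows "finite E" "independent E"
proof -
  show ind: "independent E"
    unfolding real_vector.independent_explicit_finite_subsets
  proof (intro allI impI ballI)
    fix S u v
    assume S: "S \<subseteq> E" "finite S" and z: "(\<Sum>v\<in>S. u v *\<^sub>R v) = 0" and v: "v \<in> S"
    have "0 = ip (\<Sum>w\<in>S. u w *\<^sub>R w) v" by (simp add: z ip_simps)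
    also have "\<dots> = (\<Sum>w\<in>S. u w * ip w v)" by (simp add: ip_sum_left ip_simps)
    also have "\<dots> = (\<Sum>w\<in>S. if w = v then u v * ip v v else 0)"
      by (intro sum.cong refl) (use ort S v in auto)
    also have "\<dots> = u v * ip v v" using S v by simp
    finally show "u v = 0" using v S \<open>0 \<notin> E\<close> by auto
  qed
  obtain B :: "'a set" where "finite B" "span B = UNIV"
    using findim by (auto simp: finite_dimensional_def)
  then show "finite E" using real_vector.independent_span_bound[of B E] ind by auto
qed

lemma
  assumes "orthonormal E"
  shows orthonormal_finite: "finite E" and orthonormal_independent: "independent E"
proof -
  have "ip x y = 0" if "x \<in> E" "y \<in> E" "x \<noteq> y" for x y
    using assms that by (simp add: orthonormal_def)
  moreover have "0 \<notin> E"
  proof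
    assume "0 \<in> E"
    then have "ip 0 0 = 1" using assms by (simp add: orthonormal_def)
    then show False by (simp add: ip_simps)
  qed
  ultimately show "finite E" "independent E" using orthogonal_independent by blast+
qed

lemma orthonormal_card_dim: "orthonormal E \<Longrightarrow> dim (span E) = card E"
  using orthonormal_independent by (rule dim_span_eq_card_independent)

lemma proj_in_span: "proj E x \<in> span E"
  unfolding proj_def by (intro span_sum span_scale span_base)

lemma ip_proj_residual:
  assumes E: "orthonormal E" and e: "e \<in> E"
  shows "ip (x - proj E x) e = 0"
proof -
  have "ip (proj E x) e = (\<Sum>f\<in>E. if f = e then ip x e else 0)"
    unfolding proj_def ip_sum_left ip_simps
    by (intro sum.cong refl) (use E e in \<open>auto simp: orthonormal_def\<close>)
  also have "\<dots> = ip x e" using e orthonormal_finite[OF E] by simp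
  finally show ?thesis by (simp add: ip_simps)
qed

lemma perp_span: "perp (span E) = perp E"
proof
  show "perp (span E) \<subseteq> perp E" by (auto simp: perp_def span_base)
  show "perp E \<subseteq> perp (span E)"
  proof
    fix x assume "x \<in> perp E"
    moreover have "subspace {y. ip x y = 0}" by (auto simp: subspace_def ip_simps)
    ultimately have "span E \<subseteq> {y. ip x y = 0}" by (intro span_minimal) (auto simp: perp_def)
    then show "x \<in> perp (span E)" by (auto simp: perp_def)
  qed
qed

lemma proj_residual_perp: "orthonormal E \<Longrightarrow> x - proj E x \<in> perp (span E)"
  unfolding perp_span by (simp add: perp_def ip_proj_residual)

lemma perp_disjoint: "x \<in> U \<Longrightarrow> x \<in> perp U \<Longrightarrow> x = 0"
  by (auto simp: perp_def)

lemma proj_id: "orthonormal E \<Longrightarrow> x \<in> span E \<Longrightarrow> proj E x = x"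
  using perp_disjoint[of "x - proj E x" "span E"] proj_residual_perp[of E x] proj_in_span[of E x]
  by (simp add: span_diff)

lemma bessel:
  assumes E: "orthonormal E"
  shows "ip x x - (\<Sum>e\<in>E. ip x e * ip x e) = ip (x - proj E x) (x - proj E x)"
proof -
  have "ip (x - proj E x) (proj E x) = 0"
    using proj_residual_perp[OF E] proj_in_span by (auto simp: perp_def)
  then have "ip (x - proj E x) (x - proj E x) = ip x x - ip (proj E x) x"
    by (simp add: ip_simps)
  also have "ip (proj E x) x = (\<Sum>e\<in>E. ip x e * ip x e)"
    unfolding proj_def ip_sum_left ip_simps by (simp add: ip_sym)
  finally show ?thesis by simp
qed

lemma parseval:
  assumes E: "orthonormal E" and "x \<in> span E"
  shows "ip x y = (\<Sum>e\<in>E. ip x e * ip y e)"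
proof -
  have "ip x y = ip (proj E x) y" using assms by (simp add: proj_id)
  then show ?thesis unfolding proj_def ip_sum_left ip_simps by (simp add: ip_sym)
qed

text \<open>
  An orthonormal set is independent, so its size is bounded and a largest one inside \<open>Q\<close> exists;
  whenever it fails to span \<open>V\<close> it could be enlarged. With \<open>Q = V\<close> this yields orthonormal bases,
  and with the set of eigenvectors of an operator as \<open>Q\<close> it yields the spectral theorem.
\<close>

lemma orthonormal_spanning_subset:
  assumes step: "\<And>F. orthonormal F \<Longrightarrow> F \<subseteq> Q \<Longrightarrow> \<not> V \<subseteq> span F \<Longrightarrow> \<exists>v\<in>Q. v \<noteq> 0 \<and> v \<in> perp F"
    and scale: "\<And>v c. v \<in> Q \<Longrightarrow> c *\<^sub>R v \<in> Q"
  obtains F where "orthonormal F" "F \<subseteq> Q" "V \<subseteq> span F"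
proof -
  obtain B :: "'a set" where B: "finite B" "span B = UNIV"
    using findim by (auto simp: finite_dimensional_def)
  define P where "P F \<longleftrightarrow> orthonormal F \<and> F \<subseteq> Q" for F
  have "card F < Suc (card B)" if "P F" for F
  proof -
    have "independent F" using that orthonormal_independent by (simp add: P_def)
    then show ?thesis
      using real_vector.independent_span_bound[of B F] B by (simp add: less_Suc_eq_le)
  qed
  then have "\<forall>F. P F \<longrightarrow> card F < Suc (card B)" by blast
  moreover have "P {}" by (simp add: P_def orthonormal_def)
  ultimately have "\<exists>F. P F \<and> (\<forall>F'. P F' \<longrightarrow> card F' \<le> card F)"
    by (rule ex_has_greatest_nat[rotated])
  then obtain F where PF: "P F" and max: "\<And>F'. P F' \<Longrightarrow> card F' \<le> card F" by blast
  from PF have F: "orthonormal F" "F \<subseteq> Q" by (simp_all add: P_def)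
  have "V \<subseteq> span F"
  proof (rule ccontr)
    assume "\<not> V \<subseteq> span F"
    then obtain v where v: "v \<in> Q" "v \<noteq> 0" "v \<in> perp F" using step F by blast
    define u where "u = (1 / sqrt (ip v v)) *\<^sub>R v"
    have "ip u u = 1" unfolding u_def using v(2) by (rule ip_normalized)
    moreover have up: "ip u f = 0" "ip f u = 0" if "f \<in> F" for f
      using v that ip_sym[of f v] by (auto simp: u_def perp_def ip_simps)
    moreover have "u \<notin> F" using up \<open>ip u u = 1\<close> by force
    moreover have "u \<in> Q" using scale[OF v(1)] by (simp add: u_def)
    ultimately have "P (insert u F)" using F by (auto simp: orthonormal_def P_def)
    then have "card (insert u F) \<le> card F" by (rule max)
    then show False using \<open>u \<notin> F\<close> orthonormal_finite[OF F(1)] by simp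
  qed
  then show thesis using F by (intro that)
qed

lemma orthonormal_basis:
  assumes V: "subspace V"
  obtains F where "orthonormal F" "span F = V"
proof -
  have step: "\<exists>v\<in>V. v \<noteq> 0 \<and> v \<in> perp F" if F: "orthonormal F" "F \<subseteq> V" "\<not> V \<subseteq> span F" for F
  proof -
    obtain x where x: "x \<in> V" "x \<notin> span F" using F by blast
    then have "x - proj F x \<noteq> 0" using proj_in_span[of F x] by auto
    moreover have "x - proj F x \<in> perp F" using ip_proj_residual[OF F(1)] by (simp add: perp_def)
    moreover have "x - proj F x \<in> V"
      using proj_in_span[of F x] span_minimal[OF F(2) V] x V by (blast intro: subspace_diff)
    ultimately show ?thesis by blast
  qed
  have scale: "c *\<^sub>R v \<in> V" if "v \<in> V" for v c using V that by (rule subspace_scale)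
  obtain F where F: "orthonormal F" "F \<subseteq> V" "V \<subseteq> span F"
    by (rule orthonormal_spanning_subset[where V = V]) (assumption | rule step scale)+
  then have "span F = V" using span_minimal[OF F(2) V] by blast
  with F that show thesis by blast
qed

lemma perp_decompose:
  assumes "subspace V" obtains u v where "x = u + v" "u \<in> V" "v \<in> perp V"
proof -
  obtain F where F: "orthonormal F" "span F = V" using orthonormal_basis[OF assms] .
  show thesis
  proof (rule that[of "proj F x" "x - proj F x"])
    show "proj F x \<in> V" using proj_in_span[of F x] F(2) by simp
    show "x - proj F x \<in> perp V" using proj_residual_perp[OF F(1), of x] F(2) by simp
  qed simp
qed

lemma dim_perp:
  assumes U: "subspace U" "subspace V" "U \<subseteq> V"
  shows "dim V = dim U + dim (V \<inter> perp U)"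
proof -
  obtain E where E: "orthonormal E" "span E = U" using orthonormal_basis U by blast
  obtain F where F: "orthonormal F" "span F = V \<inter> perp U"
    using orthonormal_basis[OF subspace_inter[OF U(2) subspace_perp]] .
  have EF: "ip e f = 0" "ip f e = 0" if "e \<in> E" "f \<in> F" for e f
  proof -
    have "f \<in> perp U" using F(2) span_base[OF that(2)] by auto
    moreover have "e \<in> U" using E(2) span_base[OF that(1)] by auto
    ultimately show "ip f e = 0" by (simp add: perp_def)
    then show "ip e f = 0" by (simp add: ip_sym)
  qed
  have disj: "E \<inter> F = {}"
  proof (rule ccontr)
    assume "E \<inter> F \<noteq> {}"
    then obtain e where e: "e \<in> E" "e \<in> F" by blast
    have "ip e e = 1" using E(1) e by (simp add: orthonormal_def)
    with EF[OF e] show False by simp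
  qed
  have on: "orthonormal (E \<union> F)"
    unfolding orthonormal_def
  proof (intro ballI)
    fix x y assume "x \<in> E \<union> F" "y \<in> E \<union> F"
    then show "ip x y = (if x = y then 1 else 0)"
      using E(1) F(1) EF disj by (cases "x \<in> E"; cases "y \<in> E") (auto simp: orthonormal_def)
  qed
  have "span (E \<union> F) = V"
  proof
    have "E \<subseteq> V" using span_superset[of E] E(2) U(3) by simp
    moreover have "F \<subseteq> V" using span_superset[of F] F(2) by simp
    ultimately show "span (E \<union> F) \<subseteq> V" using U(2) by (intro span_minimal) auto
    show "V \<subseteq> span (E \<union> F)"
    proof
      fix x assume x: "x \<in> V"
      obtain u v where uv: "x = u + v" "u \<in> U" "v \<in> perp U" using perp_decompose[OF U(1)] .
      have "x - u \<in> V" using x uv(2) U by (blast intro: subspace_diff)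
      then have "v \<in> V" using uv(1) by simp
      then show "x \<in> span (E \<union> F)" using uv E F unfolding span_Un by auto
    qed
  qed
  then have "dim V = card (E \<union> F)" using orthonormal_card_dim[OF on] by simp
  also have "\<dots> = card E + card F"
    using disj orthonormal_finite E(1) F(1) by (simp add: card_Un_disjoint)
  also have "\<dots> = dim U + dim (V \<inter> perp U)"
    using orthonormal_card_dim[OF E(1)] orthonormal_card_dim[OF F(1)] E(2) F(2) by simp
  finally show ?thesis .
qed

lemma dim_psubset:
  fixes U V :: "'a set"
  assumes U: "subspace U" "subspace V" "U \<subset> V"
  shows "dim U < dim V"
proof -
  obtain x where x: "x \<in> V" "x \<notin> U" using U by blast
  obtain u v where uv: "x = u + v" "u \<in> U" "v \<in> perp U" using perp_decompose[OF U(1)] .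
  have "x - u \<in> V" using x uv(2) U by (blast intro: subspace_diff)
  then have v: "v \<in> V \<inter> perp U" "v \<noteq> 0" using x uv by auto
  obtain F where F: "orthonormal F" "span F = V \<inter> perp U"
    using orthonormal_basis[OF subspace_inter[OF U(2) subspace_perp]] .
  have "F \<noteq> {}" using F v by auto
  then have "dim (V \<inter> perp U) > 0"
    using orthonormal_card_dim[OF F(1)] F orthonormal_finite[OF F(1)] by (metis card_gt_0_iff)
  then show ?thesis using dim_perp[of U V] U by simp
qed

lemma riesz:
  fixes f :: "'a \<Rightarrow> real"
  assumes "linear f" obtains z where "\<And>w. f w = ip z w"
proof -
  obtain E where E: "orthonormal E" "span E = UNIV" using orthonormal_basis[OF subspace_UNIV] .
  have "f w = ip (\<Sum>e\<in>E. f e *\<^sub>R e) w" for w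
  proof -
    have "f w = f (proj E w)" using proj_id[OF E(1)] E by simp
    also have "\<dots> = ip (\<Sum>e\<in>E. f e *\<^sub>R e) w"
      unfolding proj_def using assms
      by (simp add: linear_sum linear_scale ip_sum_left ip_sum_right ip_simps ip_sym[of _ w] mult.commute)
    finally show ?thesis .
  qed
  then show ?thesis using that by blast
qed

text \<open>
  Restricted to \<open>span E\<close>, both operators have matrices in the basis \<open>E\<close>, and the traces of the two
products are the same double sum.
\<close>

lemma trace_commutator:
  assumes E: "orthonormal E" and A: "\<And>x. x \<in> span E \<Longrightarrow> A x \<in> span E" and B: "\<And>x. x \<in> span E \<Longrightarrow> B x \<in> span E"
    and lin: "linear A" "linear B"
  shows "(\<Sum>e\<in>E. ip (A (B e) - B (A e)) e) = 0"
proof -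
  have *: "(\<Sum>e\<in>E. ip (A (B e)) e) = (\<Sum>e\<in>E. \<Sum>f\<in>E. ip (B e) f * ip (A f) e)"
    if "linear A" "\<And>x. x \<in> span E \<Longrightarrow> B x \<in> span E" for A B
  proof (intro sum.cong refl)
    fix e assume "e \<in> E"
    then have "B e \<in> span E" using that span_base by blast
    then have "A (B e) = A (proj E (B e))" using proj_id[OF E] by simp
    also have "\<dots> = (\<Sum>f\<in>E. ip (B e) f *\<^sub>R A f)"
      unfolding proj_def using that(1) by (simp add: linear_sum linear_scale)
    finally show "ip (A (B e)) e = (\<Sum>f\<in>E. ip (B e) f * ip (A f) e)"
      by (simp add: ip_sum_left ip_simps)
  qed
  have "(\<Sum>e\<in>E. ip (B (A e)) e) = (\<Sum>e\<in>E. \<Sum>f\<in>E. ip (A e) f * ip (B f) e)"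
    using *[OF lin(2) A] .
  also have "\<dots> = (\<Sum>f\<in>E. \<Sum>e\<in>E. ip (A e) f * ip (B f) e)" by (rule sum.swap)
  also have "\<dots> = (\<Sum>e\<in>E. ip (A (B e)) e)" using *[OF lin(1) B] by (simp add: mult.commute)
  finally show ?thesis by (simp add: ip_simps sum_subtractf)
qed

text \<open>
  Decompose the space into \<open>span E\<close> and its orthogonal complement. Stability of \<open>span E\<close> under \<open>A\<close>
  means that the adjoint \<open>A'\<close> has only one off-diagonal block that can be nonzero, the one leading
  from \<open>span E\<close> to the complement. The trace below is the squared Hilbert-Schmidt norm of that block.
\<close>

lemma adjoint_stable_if_trace_0:
  assumes E: "orthonormal E" and A: "\<And>x. x \<in> span E \<Longrightarrow> A x \<in> span E"
    and lin: "linear A'" and adj: "\<And>x y. ip (A x) y = ip x (A' y)"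
    and tr: "(\<Sum>e\<in>E. ip (A (A' e) - A' (A e)) e) = 0"
    and x: "x \<in> span E"
  shows "A' x \<in> span E"
proof -
  have a1: "ip (A (A' e)) e = ip (A' e) (A' e)" for e by (rule adj)
  have a2: "ip (A' (A e)) e = ip (A e) (A e)" for e
    using adj[of e "A e"] ip_sym[of e "A' (A e)"] by simp
  \<comment> \<open>The norm of \<open>A\<close> on \<open>span E\<close> is that of the compression of \<open>A'\<close> to \<open>span E\<close>.\<close>
  have "(\<Sum>e\<in>E. ip (A e) (A e)) = (\<Sum>e\<in>E. \<Sum>f\<in>E. ip (A' f) e * ip (A' f) e)"
  proof (intro sum.cong refl)
    fix e assume "e \<in> E"
    then have "A e \<in> span E" using A span_base by blast
    then have "ip (A e) (A e) = (\<Sum>f\<in>E. ip (A e) f * ip (A e) f)" by (rule parseval[OF E])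
    then show "ip (A e) (A e) = (\<Sum>f\<in>E. ip (A' f) e * ip (A' f) e)"
      by (simp only: adj ip_sym[of e])
  qed
  also have "\<dots> = (\<Sum>f\<in>E. \<Sum>e\<in>E. ip (A' f) e * ip (A' f) e)" by (rule sum.swap)
  finally have "(\<Sum>f\<in>E. ip (A' f) (A' f) - (\<Sum>e\<in>E. ip (A' f) e * ip (A' f) e)) = 0"
    using tr by (simp add: ip_simps sum_subtractf a1 a2)
  then have "(\<Sum>f\<in>E. ip (A' f - proj E (A' f)) (A' f - proj E (A' f))) = 0"
    by (simp add: bessel[OF E])
  then have "A' f = proj E (A' f)" if "f \<in> E" for f
    using that sum_nonneg_eq_0_iff[OF orthonormal_finite[OF E], of "\<lambda>f. ip (A' f - proj E (A' f)) (A' f - proj E (A' f))"]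
    by (auto simp: ip_nonneg)
  then have "A' f \<in> span E" if "f \<in> E" for f using proj_in_span that by metis
  then have "E \<subseteq> A' -` span E" by auto
  moreover have "subspace (A' -` span E)" using lin by (rule linear_subspace_vimage) simp
  ultimately show ?thesis using x span_minimal by blast
qed

lemma bilinear_expand:
  fixes \<beta> :: "'a \<Rightarrow> 'a \<Rightarrow> real"
  assumes \<beta>: "bilinear \<beta>" and E: "orthonormal E" "span E = UNIV"
  shows "\<beta> x y = (\<Sum>e\<in>E. \<Sum>f\<in>E. ip x e * ip y f * \<beta> e f)"
proof -
  have l: "linear (\<lambda>x. \<beta> x y)" for y using \<beta> by (simp add: bilinear_def)
  have r: "linear (\<beta> x)" for x using \<beta> by (simp add: bilinear_def)
  have "\<beta> x y = \<beta> (proj E x) (proj E y)" using proj_id[OF E(1)] E(2) by simp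
  also have "\<dots> = (\<Sum>e\<in>E. \<beta> (ip x e *\<^sub>R e) (proj E y))"
    unfolding proj_def[of E x] by (rule linear_sum[OF l])
  also have "\<dots> = (\<Sum>e\<in>E. ip x e * (\<Sum>f\<in>E. ip y f * \<beta> e f))"
    unfolding proj_def by (simp add: linear_scale[OF l] linear_sum[OF r] linear_scale[OF r] sum_distrib_left mult.left_commute)
  finally show ?thesis by (simp add: sum_distrib_left mult.assoc)
qed

definition isometry :: "('a \<Rightarrow> 'a) \<Rightarrow> bool" where
  "isometry T \<longleftrightarrow> linear T \<and> (\<forall>x y. ip (T x) (T y) = ip x y)"

lemma isometry_bij: assumes "isometry T" shows "bij T"
proof -
  have lin: "linear T" and iso: "\<And>x y. ip (T x) (T y) = ip x y" using assms by (auto simp: isometry_def)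
  have inj: "inj T"
  proof (rule injI)
    fix x y assume "T x = T y"
    then have "T (x - y) = 0" by (simp add: linear_diff[OF lin])
    then have "ip (x - y) (x - y) = 0" using iso[of "x - y" "x - y"] by (simp add: ip_simps)
    then show "x = y" by simp
  qed
  obtain E where E: "orthonormal E" "span E = UNIV" using orthonormal_basis[OF subspace_UNIV] .
  have TE: "orthonormal (T ` E)"
    using E(1) iso inj by (auto simp: orthonormal_def inj_eq)
  have "span (T ` E) = UNIV"
  proof (rule ccontr)
    assume "span (T ` E) \<noteq> UNIV"
    then have "dim (span (T ` E)) < dim (UNIV :: 'a set)" by (intro dim_psubset) auto
    moreover have "dim (span (T ` E)) = card E"
      using orthonormal_card_dim[OF TE] card_image[OF inj_on_subset[OF inj subset_UNIV]] by simp
    ultimately show False using orthonormal_card_dim[OF E(1)] E(2) by simp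
  qed
  moreover have "span (T ` E) \<subseteq> range T"
    using lin linear_subspace_image[OF lin subspace_UNIV] by (intro span_minimal) auto
  ultimately have "surj T" by blast
  with inj show ?thesis by (simp add: bij_def)
qed

lemma isometry_comp: "isometry S \<Longrightarrow> isometry T \<Longrightarrow> isometry (\<lambda>x. S (T x))"
  using linear_compose[of T S] by (auto simp: isometry_def o_def)

end

section \<open>Symmetric operators\<close>

text \<open>
  Vectors and operators will be encoded by their coordinates with respect to an orthonormal basis,
  which is a set and not a type; so Tychonoff's theorem takes the place of Heine-Borel.
\<close>

lemma compact_coordinate_box:
  "compact {c :: 'i \<Rightarrow> real. \<forall>i. if i \<in> I then \<bar>c i\<bar> \<le> 1 else c i = 0}"
proof -
  have "{c :: 'i \<Rightarrow> real. \<forall>i. if i \<in> I then \<bar>c i\<bar> \<le> 1 else c i = 0}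
      = PiE UNIV (\<lambda>i. if i \<in> I then {-1..1} else {0})"
    by (auto simp: PiE_def Pi_def abs_le_iff split: if_splits)
  moreover have "compactin (product_topology (\<lambda>_. euclidean) UNIV)
      (PiE UNIV (\<lambda>i::'i. if i \<in> I then {-1..1::real} else {0}))"
    by (subst compactin_PiE) auto
  ultimately show ?thesis by (simp add: euclidean_product_topology)
qed

context inner_space
begin

text \<open>
  A vector \<open>x\<close> at which the quadratic form of \<open>S\<close> is largest on the unit sphere is an eigenvector.
  If \<open>l\<close> is the maximum, the form \<open>R\<close> associated with \<open>l - S\<close> is positive semidefinite and
  vanishes at \<open>x\<close>, so by the argument of Cauchy and Schwarz \<open>x\<close> lies in its kernel.
\<close>

lemma symmetric_eigenvector:
  assumes lin: "linear S" and sym: "\<And>x y. ip (S x) y = ip x (S y)"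
    and V: "subspace V" "\<And>x. x \<in> V \<Longrightarrow> S x \<in> V" "V \<noteq> {0}"
  obtains x l where "x \<in> V" "x \<noteq> 0" "S x = l *\<^sub>R x"
proof -
  obtain E where E: "orthonormal E" "span E = V" using orthonormal_basis[OF V(1)] .
  note fin = orthonormal_finite[OF E(1)]
  define vec where "vec c = (\<Sum>e\<in>E. c e *\<^sub>R e)" for c
  define K where "K = {c :: 'a \<Rightarrow> real. \<forall>i. if i \<in> E then \<bar>c i\<bar> \<le> 1 else c i = 0} \<inter>
      {c. (\<Sum>e\<in>E. c e * c e) = 1}"
  have norm: "ip (vec c) (vec c) = (\<Sum>e\<in>E. c e * c e)" for c
  proof -
    have "ip e (vec c) = c e" if "e \<in> E" for e
    proof -
      have "ip e (vec c) = (\<Sum>f\<in>E. if f = e then c e else 0)"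
        unfolding vec_def ip_sum_right ip_simps
        by (intro sum.cong refl) (use E that in \<open>auto simp: orthonormal_def\<close>)
      then show ?thesis using that fin by simp
    qed
    then show ?thesis by (subst vec_def) (simp add: ip_sum_left ip_simps)
  qed
  have closed: "closed {c :: 'a \<Rightarrow> real. (\<Sum>e\<in>E. c e * c e) = 1}"
    by (intro closed_Collect_eq continuous_intros continuous_on_product_coordinates)
  have "compact K" unfolding K_def by (intro compact_Int_closed compact_coordinate_box closed)
  moreover have coord: "(\<lambda>e. if e \<in> E then ip x e else 0) \<in> K" "vec (\<lambda>e. if e \<in> E then ip x e else 0) = x"
    if "x \<in> V" "ip x x = 1" for x
  proof -
    have x: "x \<in> span E" using that E by simp
    have "vec (\<lambda>e. if e \<in> E then ip x e else 0) = proj E x"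
      unfolding vec_def proj_def by (intro sum.cong) auto
    then show "vec (\<lambda>e. if e \<in> E then ip x e else 0) = x" using proj_id[OF E(1) x] by simp
    have one: "(\<Sum>e\<in>E. ip x e * ip x e) = 1" using parseval[OF E(1) x, of x] that by simp
    have "\<bar>ip x e\<bar> \<le> 1" if "e \<in> E" for e
    proof -
      have "ip x e * ip x e \<le> 1"
        using member_le_sum[OF that, of "\<lambda>e. ip x e * ip x e"] fin one by simp
      then show ?thesis using abs_square_le_1[of "ip x e"] by (simp add: power2_eq_square)
    qed
    then show "(\<lambda>e. if e \<in> E then ip x e else 0) \<in> K" using one by (simp add: K_def)
  qed
  moreover have "K \<noteq> {}"
  proof -
    obtain v where v: "v \<in> V" "v \<noteq> 0" using V subspace_0 by blast
    define u where "u = (1 / sqrt (ip v v)) *\<^sub>R v"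
    have "ip u u = 1" unfolding u_def using v(2) by (rule ip_normalized)
    moreover have "u \<in> V" using v V by (auto simp: u_def intro: subspace_scale)
    ultimately show ?thesis using coord(1) by blast
  qed
  moreover have "continuous_on K (\<lambda>c. ip (S (vec c)) (vec c))"
  proof -
    have "ip (S (vec c)) (vec c) = (\<Sum>e\<in>E. c e * (\<Sum>f\<in>E. c f * ip (S f) e))" for c
      unfolding vec_def by (simp add: linear_sum[OF lin] linear_scale[OF lin] ip_sum_left ip_sum_right ip_simps sum_distrib_left)
    then show ?thesis
      by (auto intro!: continuous_intros continuous_on_product_then_coordinatewise[OF continuous_on_id])
  qed
  ultimately obtain c where c: "c \<in> K" "\<And>d. d \<in> K \<Longrightarrow> ip (S (vec d)) (vec d) \<le> ip (S (vec c)) (vec c)"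
    using continuous_attains_sup[of K "\<lambda>c. ip (S (vec c)) (vec c)"] by blast
  define x where "x = vec c"
  define l where "l = ip (S x) x"
  have x1: "ip x x = 1" using c(1) by (simp add: x_def norm K_def)
  have xV: "x \<in> V" unfolding x_def vec_def E(2)[symmetric] by (intro span_sum span_scale span_base)
  have unit: "ip (S v) v \<le> l" if "v \<in> V" "ip v v = 1" for v
    using coord[OF that] c(2) unfolding l_def x_def by metis
  define R where "R u v = l * ip u v - ip (S u) v" for u v
  have R: "R v v \<ge> 0" if "v \<in> V" for v
  proof (cases "v = 0")
    case True then show ?thesis using linear_0[OF lin] by (simp add: R_def ip_simps)
  next
    case False
    define u where "u = (1 / sqrt (ip v v)) *\<^sub>R v"
    have p: "ip v v > 0" using False by (rule ip_pos)
    have "ip u u = 1" unfolding u_def using False by (rule ip_normalized)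
    moreover have "u \<in> V" using that V by (auto simp: u_def intro: subspace_scale)
    ultimately have "ip (S u) u \<le> l" using unit by blast
    also have "ip (S u) u = ip (S v) v / ip v v"
      using p by (simp add: u_def ip_simps linear_scale[OF lin] field_simps)
    finally show ?thesis using p by (simp add: R_def field_simps)
  qed
  have R0: "R x x = 0" by (simp add: R_def l_def x1)
  have "R x y = 0" if y: "y \<in> V" for y
  proof (rule ccontr)
    assume n: "R x y \<noteq> 0"
    have exp: "R (x + t *\<^sub>R y) (x + t *\<^sub>R y) = 2 * t * R x y + t * t * R y y" for t
      using R0 sym[of y x] ip_sym[of y "S x"] ip_sym[of y x]
      unfolding R_def by (simp add: ip_simps linear_add[OF lin] linear_scale[OF lin] algebra_simps)
    \<comment> \<open>A step against the sign of \<open>R x y\<close>, short enough for the linear term to win over the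
        quadratic one; the summand 1 covers the case \<open>R y y = 0\<close>.\<close>
    define t where "t = - R x y / (R y y + 1)"
    have d: "R y y + 1 > 0" using R[OF y] by simp
    have "x + t *\<^sub>R y \<in> V" using xV y V by (auto intro: subspace_add subspace_scale)
    then have "0 \<le> 2 * t * R x y + t * t * R y y" using R exp by metis
    also have "\<dots> \<le> 2 * t * R x y + t * t * (R y y + 1)" by (simp add: algebra_simps)
    also have "t * t * (R y y + 1) = - t * R x y" using d by (simp add: t_def)
    finally have "0 \<le> t * R x y" by simp
    moreover have "t * R x y = - (R x y * R x y) / (R y y + 1)" by (simp add: t_def)
    moreover have "R x y * R x y > 0" using n by (simp add: zero_less_mult_iff linorder_neq_iff) linarith
    ultimately show False using d by (simp add: field_simps zero_le_divide_iff)
  qed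
  then have "ip (l *\<^sub>R x - S x) y = 0" if "y \<in> V" for y
    using that by (simp add: R_def ip_simps)
  moreover have "l *\<^sub>R x - S x \<in> V" using xV V by (auto intro: subspace_diff subspace_scale)
  ultimately have "S x = l *\<^sub>R x" using ip_eq_0_iff by (metis right_minus_eq)
  moreover have "x \<noteq> 0" using x1 by (auto simp: ip_simps)
  ultimately show ?thesis using that xV by blast
qed

lemma spectral_theorem:
  assumes lin: "linear S" and sym: "\<And>x y. ip (S x) y = ip x (S y)"
  obtains E l where "orthonormal E" "span E = UNIV" "\<And>e. e \<in> E \<Longrightarrow> S e = l e *\<^sub>R e"
proof -
  define Q where "Q = {x. \<exists>l. S x = l *\<^sub>R x}"
  have step: "\<exists>v\<in>Q. v \<noteq> 0 \<and> v \<in> perp F" if F: "orthonormal F" "F \<subseteq> Q" "\<not> UNIV \<subseteq> span F" for F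
  proof -
    have "S x \<in> perp F" if "x \<in> perp F" for x
    proof -
      have "ip (S x) f = 0" if f: "f \<in> F" for f
      proof -
        obtain l where "S f = l *\<^sub>R f" using F f by (auto simp: Q_def)
        then show ?thesis using \<open>x \<in> perp F\<close> f sym[of x f] by (simp add: ip_simps perp_def)
      qed
      then show ?thesis by (simp add: perp_def)
    qed
    moreover have "perp F \<noteq> {0}"
    proof
      assume 0: "perp F = {0}"
      have "x = proj F x" for x using proj_residual_perp[OF F(1), of x] 0 unfolding perp_span by simp
      then have "x \<in> span F" for x using proj_in_span by metis
      then show False using F by blast
    qed
    ultimately obtain x l where "x \<in> perp F" "x \<noteq> 0" "S x = l *\<^sub>R x"
      using symmetric_eigenvector[OF lin sym subspace_perp] by metis
    then show ?thesis by (auto simp: Q_def)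
  qed
  have sc: "c *\<^sub>R v \<in> Q" if "v \<in> Q" for v c
    using that by (auto simp: Q_def linear_scale[OF lin] scaleR_left_commute)
  obtain F where F: "orthonormal F" "F \<subseteq> Q" "UNIV \<subseteq> span F"
    by (rule orthonormal_spanning_subset[where V = UNIV]) (assumption | rule step sc)+
  have "\<forall>e\<in>F. \<exists>l. S e = l *\<^sub>R e" using F by (auto simp: Q_def)
  then obtain l where "\<And>e. e \<in> F \<Longrightarrow> S e = l e *\<^sub>R e" by metis
  then show ?thesis using that[of F l] F by blast
qed

end

section \<open>Complex structures on real vector spaces\<close>

context inner_space
begin

text \<open>
  Pair up the members of an orthonormal basis and rotate each pair by a right angle.
\<close>

lemma complex_structure_exists:
  assumes V: "subspace V" and even: "even (dim V)"
  obtains k where "linear k" "\<And>x. k x \<in> V" "\<And>x. x \<in> V \<Longrightarrow> k (k x) = - x" "\<And>x. x \<in> perp V \<Longrightarrow> k x = 0"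
proof -
  obtain E where E: "orthonormal E" "span E = V" using orthonormal_basis[OF V] .
  note fin = orthonormal_finite[OF E(1)]
  have "even (card E)" using even orthonormal_card_dim[OF E(1)] E(2) by simp
  then obtain n where n: "card E = n + n" by (metis evenE mult_2)
  obtain A where A: "A \<subseteq> E" "card A = n" using obtain_subset_with_card_n[of n E] n by auto
  have finA: "finite A" "finite (E - A)" using fin A finite_subset by auto
  have "card (E - A) = n" using A n finA by (simp add: card_Diff_subset)
  then obtain f where f: "bij_betw f A (E - A)"
    using finite_same_card_bij[OF finA] A(2) by auto
  have fE: "f a \<in> E" "f a \<notin> A" "a \<in> E" if "a \<in> A" for a
    using that f A(1) by (auto simp: bij_betw_def)
  have ort: "ip a b = (if a = b then 1 else 0)" "ip (f a) (f b) = (if a = b then 1 else 0)"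
    "ip a (f b) = 0" "ip (f b) a = 0" if "a \<in> A" "b \<in> A" for a b
    using E(1) fE[OF that(1)] fE[OF that(2)] that bij_betw_imp_inj_on[OF f]
    by (auto simp: orthonormal_def inj_on_eq_iff)
  define k where "k x = (\<Sum>a\<in>A. ip x a *\<^sub>R f a - ip x (f a) *\<^sub>R a)" for x
  have lin: "linear k"
    unfolding k_def by (rule linearI) (simp_all add: ip_simps scaleR_add_left scaleR_diff_right sum.distrib sum_subtractf scaleR_sum_right)
  have ka: "k a = f a" and kfa: "k (f a) = - a" if a: "a \<in> A" for a
  proof -
    have "k a = (\<Sum>b\<in>A. if b = a then f a else 0)"
      unfolding k_def using ort a by (intro sum.cong refl) auto
    then show "k a = f a" using a finA by simp
    have "k (f a) = (\<Sum>b\<in>A. if b = a then - a else 0)"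
      unfolding k_def using ort a by (intro sum.cong refl) auto
    then show "k (f a) = - a" using a finA by simp
  qed
  have kk: "k (k x) = - x" if "x \<in> V" for x
  proof (rule linear_eq_on_span[of "\<lambda>x. k (k x)" uminus E])
    show "linear (\<lambda>x. k (k x))" using linear_compose[OF lin lin] by (simp add: o_def)
    show "linear (uminus :: 'a \<Rightarrow> 'a)" by (rule linearI) auto
    show "x \<in> span E" using that E by simp
    show "k (k e) = - e" if e: "e \<in> E" for e
    proof (cases "e \<in> A")
      case True
      then show ?thesis using ka kfa by simp
    next
      case False
      then obtain a where "a \<in> A" "e = f a" using e f by (auto simp: bij_betw_def)
      then show ?thesis using ka kfa linear_neg[OF lin] by simp
    qed
  qed
  have EV: "e \<in> V" if "e \<in> E" for e using span_base[OF that] E(2) by simp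
  show thesis
  proof (rule that[OF lin])
    show "k x \<in> V" for x
      unfolding k_def using V fE EV by (intro subspace_sum subspace_diff subspace_scale) auto
    show "k x = 0" if "x \<in> perp V" for x
    proof -
      have "ip x e = 0" if "e \<in> E" for e using \<open>x \<in> perp V\<close> EV[OF that] by (simp add: perp_def)
      then show ?thesis unfolding k_def using fE by (intro sum.neutral) simp
    qed
  qed (rule kk)
qed

text \<open>
  If \<open>k\<close> is skew, the orthogonal complement of the plane spanned by \<open>x\<close> and \<open>k x\<close> is again stable
  under \<open>k\<close>.
\<close>

lemma even_dim_skew_complex_structure:
  fixes k :: "'a \<Rightarrow> 'a"
  assumes "subspace V" and lin: "linear k" and "\<And>x. x \<in> V \<Longrightarrow> k x \<in> V" and kk: "\<And>x. x \<in> V \<Longrightarrow> k (k x) = - x"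
    and skew: "\<And>x y. x \<in> V \<Longrightarrow> y \<in> V \<Longrightarrow> ip (k x) y = - ip x (k y)"
  shows "even (dim V)"
  using assms
proof (induction "dim V" arbitrary: V rule: less_induct)
  case less
  note V = \<open>subspace V\<close> and kV = less.prems(3) and kk = less.prems(4) and skew = less.prems(5)
  show ?case
  proof (cases "V = {0}")
    case True
    then show ?thesis using dim_span_eq_card_independent[of "{} :: 'a set"] by (simp add: independent_empty)
  next
    case False
    then obtain x where x: "x \<in> V" "x \<noteq> 0" using subspace_0[OF V] by blast
    define P where "P = span {x, k x}"
    have "ip (k x) x = 0" using skew[OF x(1) x(1)] ip_sym[of x "k x"] by simp
    then have x_kx: "ip x (k x) = 0" "ip (k x) x = 0" "x \<noteq> k x" using ip_sym x(2) by auto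
    have "k x \<noteq> 0" using kk[OF x(1)] x(2) linear_0[OF lin] by auto
    then have "independent {x, k x}" using x_kx x(2) by (intro orthogonal_independent) auto
    then have dimP: "dim P = 2" unfolding P_def using x_kx(3) by (simp add: dim_eq_card_independent)
    have PV: "P \<subseteq> V" unfolding P_def using x kV V by (intro span_minimal) auto
    define W where "W = V \<inter> perp P"
    have dimV: "dim V = 2 + dim W" using dim_perp[OF _ V PV] dimP by (simp add: W_def P_def)
    have inW: "y \<in> W \<longleftrightarrow> y \<in> V \<and> ip y x = 0 \<and> ip y (k x) = 0" for y
      unfolding W_def P_def perp_span by (auto simp: perp_def)
    have "even (dim W)"
    proof (rule less.hyps)
      show "dim W < dim V" using dimV by simp
      show "subspace W" unfolding W_def by (rule subspace_inter[OF V subspace_perp])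
      show "k y \<in> W" if "y \<in> W" for y
        using that kV skew[of y x] skew[of y "k x"] x(1) kk[OF x(1)] by (simp add: inW ip_simps)
    qed (use lin kk skew inW in auto)
    then show ?thesis using dimV by simp
  qed
qed

text \<open>
  Averaging the inner product over \<open>k\<close> makes \<open>k\<close> skew.
\<close>

lemma even_dim_complex_structure:
  fixes k :: "'a \<Rightarrow> 'a"
  assumes V: "subspace V" and lin: "linear k" and kV: "\<And>x. x \<in> V \<Longrightarrow> k x \<in> V" and kk: "\<And>x. x \<in> V \<Longrightarrow> k (k x) = - x"
  shows "even (dim V)"
proof -
  define ip' where "ip' x y = ip x y + ip (k x) (k y)" for x y
  interpret I: inner_space ip'
  proof
    show "bilinear ip'"
      unfolding bilinear_def ip'_def
      by (auto intro!: linearI simp: ip_simps linear_add[OF lin] linear_scale[OF lin] algebra_simps)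
    show "ip' x y = ip' y x" for x y by (simp add: ip'_def ip_sym)
    show "ip' x x > 0" if "x \<noteq> 0" for x
      using ip_pos[OF that] ip_nonneg[of "k x"] by (simp add: ip'_def)
  qed (rule findim)
  show ?thesis
    by (rule I.even_dim_skew_complex_structure[OF V lin kV kk]) (simp_all add: ip'_def kk ip_simps)
qed

end

section \<open>Lie algebras with an invariant inner product\<close>

locale compact_lie_algebra = lie_algebra br + inner_space ip
  for br :: "'g::real_vector \<Rightarrow> 'g \<Rightarrow> 'g" and ip :: "'g \<Rightarrow> 'g \<Rightarrow> real" +
  assumes ip_invariant: "ip (br x y) z = - ip y (br x z)"

context lie_algebra
begin

lemmas br_simps = bilinear_ladd[OF bilinear_br] bilinear_radd[OF bilinear_br]
  bilinear_lmul[OF bilinear_br] bilinear_rmul[OF bilinear_br]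
  bilinear_lneg[OF bilinear_br] bilinear_rneg[OF bilinear_br]
  bilinear_lsub[OF bilinear_br] bilinear_rsub[OF bilinear_br]
  bilinear_lzero[OF bilinear_br] bilinear_rzero[OF bilinear_br]

lemma br_br_left: "br (br x y) z = br x (br y z) - br y (br x z)"
proof -
  have e: "br z (br x y) = - br (br x y) z" "br y (br z x) = - br y (br x z)"
    using br_commute[of z "br x y"] br_commute[of z x] by (simp_all add: bilinear_rneg[OF bilinear_br])
  show ?thesis using jacobi[of x y z] unfolding e by (simp add: algebra_simps)
qed

end

section \<open>Complex structures on the quotient and their lifts\<close>

lemma qproj_eq_h_iff: "subspace h \<Longrightarrow> qproj h x = h \<longleftrightarrow> x \<in> h"
  using qproj_eq_iff[of h x 0] by (simp add: qproj_0)

context lie_algebra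
begin

text \<open>
  A linear map \<open>j\<close> of the Lie algebra that preserves \<open>h\<close> turns each condition on the induced map \<open>J\<close>
  of the quotient into a congruence modulo \<open>h\<close>.
\<close>

context
  fixes h j J
  assumes h: "lie_subalgebra br h"
    and lin: "linear j" and jh: "\<And>x. x \<in> h \<Longrightarrow> j x \<in> h"
    and J: "\<And>x. J (qproj h x) = qproj h (j x)"
begin

lemma lift_subspace: "subspace h" using h by (simp add: lie_subalgebra_def)

lemma lie_subalgebra_normal: "x \<in> h \<Longrightarrow> x \<in> lie_normalizer br h"
  using h by (simp add: lie_subalgebra_def lie_normalizer_def)

lemma lift_qlinear: "qlinear h J"
  using lift_subspace by (auto simp: qlinear_def quot_def J qadd_qproj qscale_qproj linear_add[OF lin] linear_scale[OF lin])

lemma lift_qcommute_iff: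
  assumes x: "x \<in> lie_normalizer br h"
  shows "qcommute h (ad_bar br h x) J \<longleftrightarrow> (\<forall>y. br x (j y) - j (br x y) \<in> h)"
    and "qcommute h J (ad_bar br h x) \<longleftrightarrow> (\<forall>y. j (br x y) - br x (j y) \<in> h)"
  using lift_subspace by (auto simp: qcommute_def quot_def J ad_bar_qproj[OF lift_subspace x] qdiff_qproj qproj_eq_h_iff)

lemma lift_invariant_complex_structure_iff:
  "invariant_complex_structure br h J \<longleftrightarrow>
     (\<forall>x. j (j x) + x \<in> h) \<and> (\<forall>a\<in>h. \<forall>x. j (br a x) - br a (j x) \<in> h)"
proof -
  have "J (J (qproj h x)) = quminus h (qproj h x) \<longleftrightarrow> j (j x) + x \<in> h" for x
    using lift_subspace by (simp add: J quminus_qproj qproj_eq_iff)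
  then show ?thesis
    unfolding invariant_complex_structure_def
    using lift_qlinear lift_qcommute_iff(2)[OF lie_subalgebra_normal] by (auto simp: quot_def)
qed

lemma lift_integrable_iff:
  assumes "invariant_complex_structure br h J"
  shows "integrable_structure br h J \<longleftrightarrow>
     (\<forall>x y. br x y + j (br (j x) y + br x (j y)) - br (j x) (j y) \<in> h)"
proof -
  have "nijenhuis br h J (qproj h x) (qproj h y) =
      qproj h (br x y + j (br (j x) y + br x (j y)) - br (j x) (j y))" for x y
    unfolding nijenhuis_eq[OF h assms J[symmetric] J[symmetric]] nijenhuis_rep_def
    using lift_subspace by (simp add: qadd_qproj qdiff_qproj J)
  then show ?thesis unfolding integrable_structure_def using lift_subspace
    by (auto simp: quot_def qproj_eq_h_iff)
qed

end
end

text \<open>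
  Represent each coset by its element orthogonal to \<open>h\<close>. Linearity of the lift is automatic, because
  this representative is unique.
\<close>

lemma (in inner_space) perp_lift_exists:
  assumes h: "subspace h" and J: "qlinear h J"
  obtains j where "linear j" "\<And>x. j x \<in> perp h" "\<And>x. J (qproj h x) = qproj h (j x)"
proof -
  have ex: "\<exists>u. u \<in> perp h \<and> J (qproj h x) = qproj h u" for x
  proof -
    have "J (qproj h x) \<in> quot h" using J unfolding qlinear_def quot_def by blast
    then obtain y where y: "J (qproj h x) = qproj h y" unfolding quot_def by blast
    obtain u v where uv: "y = u + v" "u \<in> h" "v \<in> perp h" using perp_decompose[OF h] .
    then have "qproj h y = qproj h v" using h by (simp add: qproj_eq_iff)
    then show ?thesis using uv y by auto
  qed
  define j where "j x = (SOME u. u \<in> perp h \<and> J (qproj h x) = qproj h u)" for x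
  have j: "j x \<in> perp h" "J (qproj h x) = qproj h (j x)" for x
    using someI_ex[OF ex[of x]] unfolding j_def by auto
  have uniq: "j x = u" if u: "u \<in> perp h" "J (qproj h x) = qproj h u" for x u
  proof -
    have "qproj h (j x) = qproj h u" using j(2)[of x] u(2) by (rule trans[OF sym])
    then have "j x - u \<in> h" unfolding qproj_eq_iff[OF h] .
    moreover have "j x - u \<in> perp h" using j(1) u(1) subspace_perp by (rule subspace_diff[rotated])
    ultimately show ?thesis using perp_disjoint by fastforce
  qed
  have "linear j"
  proof (rule linearI)
    fix x y
    have "J (qproj h (x + y)) = qadd h (J (qproj h x)) (J (qproj h y))"
      using J unfolding qlinear_def quot_def qadd_qproj[OF h, symmetric] by blast
    then show "j (x + y) = j x + j y"
      by (intro uniq) (auto simp: j(2) qadd_qproj[OF h] intro: j(1) subspace_add[OF subspace_perp])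
  next
    fix c x
    have "J (qproj h (c *\<^sub>R x)) = qscale h c (J (qproj h x))"
      using J unfolding qlinear_def quot_def qscale_qproj[OF h, symmetric] by blast
    then show "j (c *\<^sub>R x) = c *\<^sub>R j x"
      by (intro uniq) (auto simp: j(2) qscale_qproj[OF h] intro: j(1) subspace_scale[OF subspace_perp])
  qed
  then show thesis using j by (rule that)
qed

section \<open>The complexification\<close>

text \<open>
  A pair \<open>(x, y)\<close> stands for \<open>x + i y\<close>. Complex vector spaces are avoided: \<open>cip\<close> is the real part of
  the Hermitian extension of \<open>ip\<close>, and all traces below are traces over the reals. Nothing is lost,
  since the operators in question are complex linear and multiplication of their argument by \<open>i\<close>
  recovers the imaginary part.
\<close>

definition (in inner_space) cip :: "'a \<times> 'a \<Rightarrow> 'a \<times> 'a \<Rightarrow> real" where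
  "cip a b = ip (fst a) (fst b) + ip (snd a) (snd b)"

lemma finite_dimensional_prod:
  assumes "finite_dimensional TYPE('a::real_vector)"
  shows "finite_dimensional TYPE('a \<times> 'a)"
proof -
  obtain B :: "'a set" where B: "finite B" "span B = UNIV"
    using assms by (auto simp: finite_dimensional_def)
  have l: "linear (\<lambda>x::'a. (x, 0::'a))" "linear (\<lambda>x::'a. (0::'a, x))"
    by (simp_all add: linear_iff)
  define S where "S = (\<lambda>x. (x, 0::'a)) ` B \<union> (\<lambda>x. (0::'a, x)) ` B"
  have "(x, 0) \<in> span S" for x
  proof -
    have "subspace ((\<lambda>x. (x, 0::'a)) -` span S)" by (rule linear_subspace_vimage[OF l(1) subspace_span])
    moreover have "B \<subseteq> (\<lambda>x. (x, 0)) -` span S" unfolding S_def by (auto intro: span_base)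
    ultimately have "span B \<subseteq> (\<lambda>x. (x, 0)) -` span S" by (intro span_minimal)
    then show ?thesis using B(2) by blast
  qed
  moreover have "(0, x) \<in> span S" for x
  proof -
    have "subspace ((\<lambda>x. (0::'a, x)) -` span S)" by (rule linear_subspace_vimage[OF l(2) subspace_span])
    moreover have "B \<subseteq> (\<lambda>x. (0, x)) -` span S" unfolding S_def by (auto intro: span_base)
    ultimately have "span B \<subseteq> (\<lambda>x. (0, x)) -` span S" by (intro span_minimal)
    then show ?thesis using B(2) by blast
  qed
  ultimately have "(x, 0) + (0, y) \<in> span S" for x y by (intro span_add) blast+
  then have "span S = UNIV" by auto
  moreover have "finite S" unfolding S_def using B(1) by simp
  ultimately show ?thesis unfolding finite_dimensional_def by blast
qed

lemma (in inner_space) inner_space_cip: "inner_space cip"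
proof
  show "bilinear cip"
    unfolding bilinear_def cip_def by (auto intro!: linearI simp: ip_simps algebra_simps)
  show "cip x y = cip y x" for x y by (simp add: cip_def ip_sym)
  show "cip x x > 0" if "x \<noteq> 0" for x
    using that ip_pos[of "fst x"] ip_pos[of "snd x"] ip_nonneg[of "fst x"] ip_nonneg[of "snd x"]
    by (cases x) (auto simp: cip_def zero_prod_def intro: add_pos_nonneg add_nonneg_pos)
qed (rule finite_dimensional_prod[OF findim])

definition (in lie_algebra) cbr :: "'g \<times> 'g \<Rightarrow> 'g \<times> 'g \<Rightarrow> 'g \<times> 'g" where
  "cbr a b = (br (fst a) (fst b) - br (snd a) (snd b), br (snd a) (fst b) + br (fst a) (snd b))"

definition cconj :: "'g \<times> 'g \<Rightarrow> 'g::real_vector \<times> 'g" where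
  "cconj a = (fst a, - snd a)"

definition imult :: "'g \<times> 'g \<Rightarrow> 'g::real_vector \<times> 'g" where
  "imult a = (- snd a, fst a)"

context lie_algebra
begin

lemma bilinear_cbr: "bilinear cbr"
  unfolding bilinear_def cbr_def by (auto intro!: linearI simp: br_simps algebra_simps)

lemma cbr_commute: "cbr a b = - cbr b a"
  unfolding cbr_def using br_commute[of "fst a" "fst b"] br_commute[of "snd a" "fst b"]
    br_commute[of "fst a" "snd b"] br_commute[of "snd a" "snd b"]
  by simp

lemma cbr_cbr_left: "cbr (cbr a b) c = cbr a (cbr b c) - cbr b (cbr a c)"
  by (simp add: cbr_def br_simps br_br_left algebra_simps)

lemma cbr_imult_left: "cbr (imult a) b = imult (cbr a b)"
  by (simp add: cbr_def imult_def br_simps algebra_simps)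

end

text \<open>
  Real elements act by skew operators, hence imaginary elements by symmetric ones.
\<close>

lemma (in compact_lie_algebra) cbr_adjoint: "cip (cbr a b) c = - cip b (cbr (cconj a) c)"
  by (simp add: cip_def cbr_def cconj_def ip_simps br_simps ip_invariant algebra_simps)

section \<open>The stabilizer of an integrable structure\<close>

text \<open>
  The data of an integrable structure \<open>J\<close> on the quotient by \<open>h\<close>, in terms of the lift \<open>j\<close> of
  \<open>J\<close> with values in the orthogonal complement of \<open>h\<close>. On that complement the congruences below
  become equations where both sides are known to lie in it.
\<close>

locale integrable_lift = compact_lie_algebra +
  fixes h j
  assumes h: "lie_subalgebra br h"
    and linj: "linear j" and j_perp: "j x \<in> perp h" and j_h: "x \<in> h \<Longrightarrow> j x \<in> h"
    and j_j: "j (j x) + x \<in> h"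
    and j_inv: "c \<in> h \<Longrightarrow> j (br c x) - br c (j x) \<in> h"
    and j_int: "br x y + j (br (j x) y + br x (j y)) - br (j x) (j y) \<in> h"
begin

interpretation cx: inner_space cip by (rule inner_space_cip)

lemma subh: "subspace h" using h by (simp add: lie_subalgebra_def)

definition q :: "('a \<times> 'a) set" where "q = {a. j (fst a) - snd a \<in> h}"
definition stab :: "'a \<times> 'a \<Rightarrow> bool" where "stab a \<longleftrightarrow> (\<forall>u\<in>q. cbr a u \<in> q)"
definition m :: "'a set" where
  "m = {x \<in> lie_normalizer br h. \<forall>y. br x (j y) - j (br x y) \<in> h}"

lemma subspace_q: "subspace q"
proof -
  have "linear (\<lambda>a. j (fst a) - snd a)"
    by (rule linearI) (simp_all add: linear_add[OF linj] linear_scale[OF linj] algebra_simps)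
  then have "subspace ((\<lambda>a. j (fst a) - snd a) -` h)" using subh by (rule linear_subspace_vimage)
  then show ?thesis by (simp add: q_def vimage_def)
qed

lemma in_q: "(x, j x) \<in> q" using subspace_0[OF subh] by (simp add: q_def)

lemma imult_q: assumes "a \<in> q" shows "imult a \<in> q"
proof -
  have "j (j (fst a) - snd a) \<in> h" using assms j_h by (simp add: q_def)
  from subspace_diff[OF subh this j_j[of "fst a"]]
  show ?thesis by (simp add: q_def imult_def linear_diff[OF linj] linear_neg[OF linj] minus_diff_commute[of "fst a"])
qed

lemma stab_add: "stab a \<Longrightarrow> stab b \<Longrightarrow> stab (a + b)"
  using subspace_add[OF subspace_q] by (simp add: stab_def bilinear_ladd[OF bilinear_cbr])

lemma stab_scale: "stab a \<Longrightarrow> stab (c *\<^sub>R a)"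
  using subspace_scale[OF subspace_q] by (simp add: stab_def bilinear_lmul[OF bilinear_cbr])

lemma stab_imult: "stab a \<Longrightarrow> stab (imult a)"
  using imult_q by (simp add: stab_def cbr_imult_left)

lemma stab_cbr: "stab a \<Longrightarrow> stab b \<Longrightarrow> stab (cbr a b)"
  using subspace_diff[OF subspace_q] by (simp add: stab_def cbr_cbr_left)

text \<open>
  The elements of \<open>m\<close> respect both \<open>h\<close> and \<open>J\<close>; both can be read off from \<open>q\<close>, as \<open>h\<close> is
  the set of its real elements.
\<close>

lemma m_iff_stab: "x \<in> m \<longleftrightarrow> stab (x, 0)"
proof
  assume x: "x \<in> m"
  show "stab (x, 0)"
    unfolding stab_def
  proof
    fix u assume "u \<in> q"
    then have "br x (j (fst u) - snd u) \<in> h" using x by (auto simp: m_def lie_normalizer_def q_def)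
    moreover have "br x (j (fst u)) - j (br x (fst u)) \<in> h" using x by (simp add: m_def)
    ultimately have "br x (j (fst u) - snd u) - (br x (j (fst u)) - j (br x (fst u))) \<in> h"
      by (rule subspace_diff[OF subh])
    then show "cbr (x, 0) u \<in> q" by (simp add: q_def cbr_def br_simps)
  qed
next
  assume st: "stab (x, 0)"
  have "br x u \<in> h" if "u \<in> h" for u
  proof -
    have "(u, 0) \<in> q" using that j_h by (simp add: q_def)
    then have "cbr (x, 0) (u, 0) \<in> q" using st by (simp add: stab_def)
    then have "j (br x u) \<in> h" by (simp add: q_def cbr_def br_simps)
    then have "j (j (br x u)) \<in> h" by (rule j_h)
    from subspace_diff[OF subh j_j[of "br x u"] this] show ?thesis by simp
  qed
  moreover have "br x (j y) - j (br x y) \<in> h" for y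
  proof -
    have "cbr (x, 0) (y, j y) \<in> q" using st in_q by (simp add: stab_def)
    then have "j (br x y) - br x (j y) \<in> h" by (simp add: q_def cbr_def br_simps)
    from subspace_neg[OF subh this] show ?thesis by simp
  qed
  ultimately show "x \<in> m" by (simp add: m_def lie_normalizer_def)
qed

lemma h_subset_m: "h \<subseteq> m"
proof
  fix c assume c: "c \<in> h"
  have "br c (j y) - j (br c y) \<in> h" for y using subspace_neg[OF subh j_inv[OF c, of y]] by simp
  then show "c \<in> m" using c h by (simp add: m_def lie_normalizer_def lie_subalgebra_def)
qed

text \<open>
  On the elements \<open>x + i j x\<close> this is the vanishing of \<open>N\<close>. Any element of \<open>q\<close> differs from such
  an element by \<open>i c\<close> with \<open>c \<in> h\<close>, and \<open>i c\<close> stabilizes \<open>q\<close> by the invariance of \<open>J\<close>.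
\<close>

lemma q_closed:
  assumes a: "a \<in> q" and b: "b \<in> q"
  shows "cbr a b \<in> q"
proof -
  have split: "\<exists>c\<in>h. u = (fst u, j (fst u)) + (0, c)" if "u \<in> q" for u
  proof -
    have "- (j (fst u) - snd u) \<in> h" using that subh by (simp only: q_def mem_Collect_eq subspace_neg)
    then show ?thesis by (intro bexI[of _ "- (j (fst u) - snd u)"]) (auto simp: prod_eq_iff)
  qed
  have st: "stab (0, c)" if "c \<in> h" for c
    using stab_imult[of "(c, 0)"] m_iff_stab h_subset_m that by (auto simp: imult_def)
  obtain c d where cd: "c \<in> h" "a = (fst a, j (fst a)) + (0, c)" "d \<in> h" "b = (fst b, j (fst b)) + (0, d)"
    using split a b by metis
  define x y where "x = fst a" and "y = fst b"
  have "cbr (x, j x) (y, j y) \<in> q"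
  proof -
    let ?p = "br x y - br (j x) (j y)" and ?r = "br (j x) y + br x (j y)"
    \<comment> \<open>Apply \<open>j\<close> to the vanishing of \<open>N x y\<close>, which is the class of \<open>?p + j ?r\<close>.\<close>
    have "j (?p + j ?r) \<in> h" using j_h[OF j_int[of x y]] by (simp add: algebra_simps)
    from subspace_diff[OF subh this j_j[of ?r]] show ?thesis
      by (simp add: q_def cbr_def linear_add[OF linj])
  qed
  moreover have "cbr (x, j x) (0, d) \<in> q"
    using st[OF cd(3)] in_q[of x] subspace_neg[OF subspace_q, of "cbr (0, d) (x, j x)"] cbr_commute[of "(x, j x)" "(0, d)"]
    by (simp add: stab_def)
  moreover have "cbr (0, c) b \<in> q" using st[OF cd(1)] b by (simp add: stab_def)
  ultimately have "(cbr (x, j x) (y, j y) + cbr (x, j x) (0, d)) + cbr (0, c) b \<in> q"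
    by (intro subspace_add[OF subspace_q])
  also have "(cbr (x, j x) (y, j y) + cbr (x, j x) (0, d)) = cbr (x, j x) b"
    using cd(4) by (metis bilinear_radd[OF bilinear_cbr] y_def)
  also have "cbr (x, j x) b + cbr (0, c) b = cbr a b"
    using cd(2) by (metis bilinear_ladd[OF bilinear_cbr] x_def)
  finally show ?thesis .
qed

lemma q_stab: "a \<in> q \<Longrightarrow> stab a"
  using q_closed by (simp add: stab_def)

text \<open>
  The vector \<open>z\<close> represents the trace functional \<open>tr\<close> on imaginary elements. The proof follows the
  outline given at the beginning.
\<close>

lemma m_is_centralizer_of_vector:
  obtains z where "m = {x. br x z = 0}"
proof -
  obtain E where E: "cx.orthonormal E" "span E = q" using cx.orthonormal_basis[OF subspace_q] .
  define tr where "tr a = (\<Sum>e\<in>E. cip (cbr a e) e)" for a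
  have lin: "linear tr"
    unfolding tr_def
    by (rule linearI) (simp_all add: bilinear_ladd[OF bilinear_cbr] bilinear_lmul[OF bilinear_cbr] cx.ip_simps
        sum.distrib sum_distrib_left)
  have cbr_lin: "linear (cbr a)" for a
    using bilinear_cbr unfolding bilinear_def by blast
  have tr_cbr: "tr (cbr a b) = 0" if "stab a" "stab b" for a b
    unfolding tr_def cbr_cbr_left
    by (rule cx.trace_commutator[OF E(1)]) (use that in \<open>auto simp: stab_def E(2) intro: cbr_lin\<close>)
  \<comment> \<open>The operators of \<open>a\<close> and of its conjugate are adjoint up to sign.\<close>
  have tr_conj: "tr (cconj a) = - tr a" for a
  proof -
    have "cip (cbr (cconj a) e) e = - cip (cbr a e) e" for e
      using cbr_adjoint[of a e e] cx.ip_sym[of e "cbr (cconj a) e"] by simp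
    then show ?thesis by (simp add: tr_def sum_negf)
  qed
  have tr_real: "tr (w, 0) = 0" for w using tr_conj[of "(w, 0)"] by (simp add: cconj_def)
  have tr_split: "tr (v, w) = tr (0, w)" for v w
    using linear_add[OF lin, of "(v, 0)" "(0, w)"] by (simp add: tr_real)
  have "linear (\<lambda>w. (0::'a, w))" by (rule linearI) auto
  from linear_compose[OF this lin] have "linear (\<lambda>w. tr (0, w))" by (simp add: o_def)
  then obtain z where z: "\<And>w. tr (0, w) = ip z w" using riesz by blast
  have "br x z = 0" if "x \<in> m" for x
  proof (rule ip_all_0)
    fix y
    \<comment> \<open>Each \<open>y\<close> is the imaginary part of an element of \<open>q\<close>, and real parts do not affect \<open>tr\<close>.\<close>
    have "imult (y, j y) \<in> q" using in_q by (rule imult_q)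
    then have "(- j y, y) \<in> q" by (simp add: imult_def)
    then have "tr (cbr (x, 0) (- j y, y)) = 0" using that m_iff_stab q_stab tr_cbr by blast
    then have "tr (- br x (j y), br x y) = 0" by (simp add: cbr_def br_simps)
    then have "tr (0, br x y) = 0" using tr_split by metis
    then show "ip (br x z) y = 0" using z ip_invariant[of x z y] by simp
  qed
  moreover have "x \<in> m" if x: "br x z = 0" for x
  proof -
    define a where "a = (x, j x)"
    have st: "stab a" unfolding a_def using in_q by (rule q_stab)
    \<comment> \<open>The bracket is \<open>- 2 i [x, j x]\<close>, so its trace is governed by the commutator of \<open>x\<close> and \<open>z\<close>.\<close>
    have "cbr a (cconj a) = (0, (-2) *\<^sub>R br x (j x))"
      using br_self[of x] br_self[of "j x"] br_commute[of "j x" x] by (simp add: cbr_def cconj_def a_def br_simps scaleR_2)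
    then have "tr (cbr a (cconj a)) = ip z ((-2) *\<^sub>R br x (j x))" using z by simp
    also have "\<dots> = 2 * ip (br x z) (j x)" using ip_invariant[of x z "j x"] by (simp add: ip_simps)
    finally have "(\<Sum>e\<in>E. cip (cbr (cbr a (cconj a)) e) e) = 0" by (simp add: x ip_simps tr_def)
    then have tr0: "(\<Sum>e\<in>E. cip (cbr a (- cbr (cconj a) e) - (- cbr (cconj a) (cbr a e))) e) = 0"
      unfolding cbr_cbr_left
      by (simp add: bilinear_rneg[OF bilinear_cbr] cx.ip_simps sum_subtractf sum_negf algebra_simps)
    have "- cbr (cconj a) u \<in> q" if "u \<in> q" for u
      using cx.adjoint_stable_if_trace_0[OF E(1), of "cbr a" "\<lambda>u. - cbr (cconj a) u" u] st tr0 that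
      by (simp add: E(2) stab_def cbr_adjoint cx.ip_simps linear_compose_neg[OF cbr_lin])
    then have "stab (cconj a)" using subspace_neg[OF subspace_q, of "- cbr (cconj a) u" for u] by (simp add: stab_def)
    then have "stab ((1/2) *\<^sub>R (a + cconj a))" using st by (intro stab_scale stab_add)
    also have "(1/2) *\<^sub>R (a + cconj a) = (x, 0)" by (simp add: a_def cconj_def flip: scaleR_2)
    finally show ?thesis by (simp add: m_iff_stab)
  qed
  ultimately have "m = {x. br x z = 0}" by blast
  then show thesis by (rule that)
qed

lemma j_j_perp: "x \<in> perp h \<Longrightarrow> j (j x) = - x"
  using perp_disjoint[OF j_j[of x]] subspace_add[OF subspace_perp[of h] j_perp[of "j x"]]
  by (simp add: eq_neg_iff_add_eq_0)

lemma m_perp: "x \<in> m \<Longrightarrow> y \<in> perp h \<Longrightarrow> br x y \<in> perp h"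
  using ip_invariant by (auto simp: perp_def m_def lie_normalizer_def)

lemma m_j_commute:
  assumes x: "x \<in> m" and y: "y \<in> perp h"
  shows "br x (j y) = j (br x y)"
proof -
  have "br x (j y) - j (br x y) \<in> h" using x by (simp add: m_def)
  moreover have "br x (j y) - j (br x y) \<in> perp h"
    using subspace_diff[OF subspace_perp] m_perp[OF x j_perp] j_perp by blast
  ultimately show ?thesis using perp_disjoint by fastforce
qed

lemma m_br: "x \<in> m \<Longrightarrow> y \<in> m \<Longrightarrow> br x y \<in> m"
  using stab_cbr[of "(x, 0)" "(y, 0)"] by (simp add: m_iff_stab cbr_def br_simps)

text \<open>
  Both \<open>x\<close> and \<open>x + i j x\<close> stabilize \<open>q\<close>, hence so does the difference \<open>i j x\<close>; and \<open>q\<close> is a complex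
  subspace.
\<close>

lemma m_j: assumes "x \<in> m" shows "j x \<in> m"
proof -
  have "stab ((x, j x) + (-1) *\<^sub>R (x, 0))"
    using assms by (intro stab_add stab_scale) (auto simp: m_iff_stab q_stab in_q)
  then have "stab ((-1) *\<^sub>R imult (0, j x))" by (intro stab_scale stab_imult) simp
  then show ?thesis by (simp add: m_iff_stab imult_def)
qed

text \<open>
  On the orthogonal complement of \<open>h\<close> in \<open>m\<close> the bracket is complex bilinear with respect to \<open>j\<close>.
  Thus \<open>(ad (j x))\<^sup>2 = - (ad x)\<^sup>2\<close> there, while the squares of the skew operators \<open>ad x\<close> and
  \<open>ad (j x)\<close> are both negative semidefinite.
\<close>

lemma complement_abelian:
  assumes x: "x \<in> m" "x \<in> perp h" and y: "y \<in> m" "y \<in> perp h"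
  shows "br x y = 0"
proof -
  have left: "br (j x) w = j (br x w)" if "w \<in> m" for w
    using m_j_commute[OF that x(2)] br_commute[of "j x" w] br_commute[of w x]
    by (simp add: linear_neg[OF linj])
  have "br (j x) (br (j x) y) = br (j x) (j (br x y))" using left[OF y(1)] by simp
  also have "\<dots> = j (br (j x) (br x y))"
    using m_j_commute[OF m_j[OF x(1)] m_perp[OF x(1) y(2)]] .
  also have "\<dots> = j (j (br x (br x y)))" using left[OF m_br[OF x(1) y(1)]] by simp
  also have "\<dots> = - br x (br x y)" using m_perp[OF x(1) m_perp[OF x(1) y(2)]] by (rule j_j_perp)
  finally have "ip (br (j x) y) (br (j x) y) = - ip (br x y) (br x y)"
    using ip_invariant[of "j x" y "br (j x) y"] ip_invariant[of x y "br x y"] by (simp add: ip_simps)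
  then show ?thesis
    using ip_nonneg[of "br (j x) y"] ip_nonneg[of "br x y"] by (metis ip_eq_0_iff neg_0_le_iff_le order_antisym)
qed

text \<open>
  Both \<open>h\<close> and its orthogonal complement in \<open>m\<close> are ideals of \<open>m\<close>, so they commute with each other,
  and the complement is abelian.
\<close>

lemma derived_m: "derived_subalgebra br m = derived_subalgebra br h"
proof
  show "derived_subalgebra br h \<subseteq> derived_subalgebra br m"
    unfolding derived_subalgebra_def using h_subset_m by (intro span_mono) blast
  have h_l: "br c v = 0" if "c \<in> h" "v \<in> m" "v \<in> perp h" for c v
  proof (rule perp_disjoint)
    have "br v c \<in> h" using that by (auto simp: m_def lie_normalizer_def)
    from subspace_neg[OF subh this] show "br c v \<in> h" using br_commute[of c v] by simp
    show "br c v \<in> perp h" using that h_subset_m m_perp by blast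
  qed
  have "\<exists>u\<in>h. \<exists>u'\<in>h. br x y = br u u'" if xy: "x \<in> m" "y \<in> m" for x y
  proof -
    have split: "\<exists>u v. x = u + v \<and> u \<in> h \<and> v \<in> perp h \<and> v \<in> m" if x: "x \<in> m" for x
    proof -
      obtain u v where uv: "x = u + v" "u \<in> h" "v \<in> perp h" using perp_decompose[OF subh] .
      have "stab ((x, 0) + (-1) *\<^sub>R (u, 0))"
        using x uv h_subset_m by (intro stab_add stab_scale) (auto simp: m_iff_stab)
      then have "v \<in> m" using uv by (simp add: m_iff_stab)
      with uv show ?thesis by blast
    qed
    obtain u v where x: "x = u + v" "u \<in> h" "v \<in> perp h" "v \<in> m" using split[OF xy(1)] by blast
    obtain u' v' where y: "y = u' + v'" "u' \<in> h" "v' \<in> perp h" "v' \<in> m" using split[OF xy(2)] by blast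
    have "br v u' = 0" using h_l[of u' v] br_commute[of v u'] x y by simp
    then have "br x y = br u u'"
      using h_l[of u v'] complement_abelian[of v v'] x y by (simp add: br_simps)
    with x y show ?thesis by blast
  qed
  then show "derived_subalgebra br m \<subseteq> derived_subalgebra br h"
    unfolding derived_subalgebra_def by (intro span_mono) blast
qed

end

lemma (in compact_lie_algebra) integrable_stabilizer:
  assumes h: "lie_subalgebra br h"
    and J: "invariant_complex_structure br h J" "integrable_structure br h J"
    and m: "m = {x \<in> lie_normalizer br h. qcommute h (ad_bar br h x) J}"
  shows "\<exists>t. abelian_subalgebra br t \<and> m = lie_centralizer br t"
    and "derived_subalgebra br m = derived_subalgebra br h" and "h \<subseteq> m"
proof -
  have sub: "subspace h" using h by (simp add: lie_subalgebra_def)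
  have qlin: "qlinear h J" using J by (simp add: invariant_complex_structure_def)
  obtain j where j: "linear j" "\<And>x. j x \<in> perp h" "\<And>x. J (qproj h x) = qproj h (j x)"
    using perp_lift_exists[OF sub qlin] by blast
  have jh: "j x \<in> h" if "x \<in> h" for x
  proof -
    have "qproj h x = qproj h 0" using that sub by (simp add: qproj_eq_iff)
    then have "qproj h (j x) = qproj h (j 0)" using j(3) by metis
    then show ?thesis using sub linear_0[OF j(1)] by (simp add: qproj_eq_iff)
  qed
  note lift = h j(1) jh j(3)
  have J': "(\<forall>x. j (j x) + x \<in> h) \<and> (\<forall>a\<in>h. \<forall>x. j (br a x) - br a (j x) \<in> h)"
    using lift_invariant_complex_structure_iff[OF lift] J(1) by (rule iffD1)
  have N: "\<forall>x y. br x y + j (br (j x) y + br x (j y)) - br (j x) (j y) \<in> h"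
    using lift_integrable_iff[OF lift J(1)] J(2) by (rule iffD1)
  interpret L: integrable_lift br ip h j
    by (intro integrable_lift.intro integrable_lift_axioms.intro compact_lie_algebra_axioms h j jh)
      (use J' N in blast)+
  have m_eq: "m = L.m" unfolding m L.m_def using lift_qcommute_iff(1)[OF lift] by blast
  obtain z where z: "L.m = {x. br x z = 0}" using L.m_is_centralizer_of_vector .
  have zz: "br x y = 0" if "x \<in> span {z}" "y \<in> span {z}" for x y
    using that by (auto simp: span_singleton br_simps br_self)
  have "abelian_subalgebra br (span {z})"
    by (simp add: abelian_subalgebra_def lie_subalgebra_def zz span_zero)
  moreover have "m = lie_centralizer br (span {z})"
  proof -
    have "br x y = 0" if "br x z = 0" "y \<in> span {z}" for x y
      using that by (auto simp: span_singleton br_simps)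
    then show ?thesis unfolding m_eq z lie_centralizer_def using span_base[of z "{z}"] by blast
  qed
  ultimately show "\<exists>t. abelian_subalgebra br t \<and> m = lie_centralizer br t" by blast
  show "derived_subalgebra br m = derived_subalgebra br h" using L.derived_m m_eq by simp
  show "h \<subseteq> m" using L.h_subset_m m_eq by simp
qed

section \<open>Generic elements of abelian subalgebras\<close>

context compact_lie_algebra
begin

lemma subspace_kernel: "subspace {x. br x z = 0}"
  by (simp add: subspace_def br_simps)

lemma br_eq_0_commute: "br x y = 0 \<longleftrightarrow> br y x = 0"
  using br_commute[of x y] by simp

lemma br_left_commute: "br y z = 0 \<Longrightarrow> br y (br z x) = br z (br y x)"
  using br_br_left[of y z x] by (simp add: br_simps)

text \<open>
  Choose \<open>z\<close> with a centralizer of least dimension. If some \<open>y \<in> t\<close> acted nontrivially on it, the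
  centralizer of \<open>z + n y\<close> would be strictly smaller for a suitable integer \<open>n\<close>: as \<open>ad y\<close>
  commutes with \<open>ad z\<close>, it is enough that \<open>ad (z + n y)\<close> is injective on the orthogonal complement
  of the centralizer of \<open>z\<close>, and this fails for only finitely many \<open>n\<close>.
\<close>

lemma generic_element:
  assumes t: "abelian_subalgebra br t"
  obtains z where "z \<in> t" "lie_centralizer br t = {x. br x z = 0}"
proof -
  define C where "C z = {x. br x z = 0}" for z
  have subt: "subspace t" and ab: "\<And>x y. x \<in> t \<Longrightarrow> y \<in> t \<Longrightarrow> br x y = 0"
    using t by (auto simp: abelian_subalgebra_def lie_subalgebra_def)
  have subC: "subspace (C z)" for z unfolding C_def by (rule subspace_kernel)
  obtain z where z: "z \<in> t" and least: "\<And>z'. z' \<in> t \<Longrightarrow> dim (C z) \<le> dim (C z')"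
    using ex_has_least_nat[of "\<lambda>z. z \<in> t" 0 "\<lambda>z. dim (C z)"] subspace_0[OF subt] by blast
  have "br v y = 0" if v: "br v z = 0" and y: "y \<in> t" for v y
  proof (rule ccontr)
    assume vy: "br v y \<noteq> 0"
    note comm = br_left_commute[OF ab[OF z y]]
    have "\<exists>n::nat. n > 0 \<and> (\<forall>w\<in>perp (C z). br (z + real n *\<^sub>R y) w = 0 \<longrightarrow> w = 0)"
    proof (rule ccontr)
      assume "\<not> ?thesis"
      then obtain w where w: "\<And>n::nat. n > 0 \<Longrightarrow> w n \<in> perp (C z) \<and> br (z + real n *\<^sub>R y) (w n) = 0 \<and> w n \<noteq> 0"
        by metis
      have zw: "br z (w n) = - (real n *\<^sub>R br y (w n))" if "n > 0" for n
        using w[OF that] by (simp add: br_simps eq_neg_iff_add_eq_0)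
      \<comment> \<open>Solutions of \<open>[z + n y, w] = 0\<close> for different \<open>n\<close> become orthogonal under \<open>ad y\<close>, because
          \<open>ad y\<close> and \<open>ad z\<close> are commuting skew operators. So only finitely many \<open>n\<close> admit one.\<close>
      have ortho: "ip (br y (w i)) (br y (w k)) = 0" if "i > 0" "k > 0" "i \<noteq> k" for i k
      proof -
        have "ip (br z (w i)) (br y (w k)) = - ip (w i) (br y (br z (w k)))"
          using ip_invariant comm by simp
        also have "\<dots> = ip (br y (w i)) (br z (w k))" using ip_invariant by simp
        finally have "real i * ip (br y (w i)) (br y (w k)) = real k * ip (br y (w i)) (br y (w k))"
          using zw that by (simp add: ip_simps)
        then show ?thesis using that by simp
      qed
      have nz: "br y (w n) \<noteq> 0" if "n > 0" for n
      proof
        assume "br y (w n) = 0"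
        then have "br z (w n) = 0" using zw[OF that] by simp
        then have "w n \<in> C z" using br_eq_0_commute by (simp add: C_def)
        then show False using w[OF that] perp_disjoint by blast
      qed
      define b where "b n = br y (w (Suc n))" for n
      have b: "ip (b i) (b k) = 0" if "i \<noteq> k" for i k using ortho that by (simp add: b_def)
      have b0: "b i \<noteq> 0" for i using nz by (simp add: b_def)
      have "inj b"
      proof (rule injI, rule ccontr)
        fix i k assume "b i = b k" "i \<noteq> k"
        then show False using b[of i k] b0[of i] by simp
      qed
      then have "infinite (range b)" by (rule range_inj_infinite)
      moreover have "finite (range b)"
      proof (rule orthogonal_independent)
        show "ip x x' = 0" if "x \<in> range b" "x' \<in> range b" "x \<noteq> x'" for x x'
          using that b by (metis rangeE)
        show "0 \<notin> range b" using b0 by (metis rangeE)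
      qed
      ultimately show False by blast
    qed
    then obtain n :: nat where n: "n > 0" and inj: "\<And>w. w \<in> perp (C z) \<Longrightarrow> br (z + real n *\<^sub>R y) w = 0 \<Longrightarrow> w = 0"
      by blast
    define z' where "z' = z + real n *\<^sub>R y"
    have z't: "z' \<in> t" unfolding z'_def using subt z y by (intro subspace_add subspace_scale)
    have bz: "br z u = 0 \<longleftrightarrow> u \<in> C z" for u using br_eq_0_commute by (simp add: C_def)
    have stabU: "br z' u \<in> C z" if u: "u \<in> C z" for u
    proof -
      have "br z (br y u) = 0" using comm[of u] bz[of u] u by (simp add: br_simps)
      then have "br y u \<in> C z" using bz by blast
      then show ?thesis using u bz[of u] subspace_scale[OF subC] by (simp add: z'_def br_simps)
    qed
    have stabP: "br z' u \<in> perp (C z)" if "u \<in> perp (C z)" for u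
      using that stabU by (auto simp: perp_def ip_invariant)
    have "C z' \<subseteq> C z"
    proof
      fix x assume "x \<in> C z'"
      then have x0: "br z' x = 0" using br_eq_0_commute by (simp add: C_def)
      obtain u w where uw: "x = u + w" "u \<in> C z" "w \<in> perp (C z)" using perp_decompose[OF subC] .
      have "br z' w = - br z' u" using x0 uw(1) by (simp add: br_simps eq_neg_iff_add_eq_0 add.commute)
      then have "br z' w \<in> C z" using stabU[OF uw(2)] subspace_neg[OF subC] by simp
      then have "br z' w = 0" using stabP[OF uw(3)] perp_disjoint by blast
      then have "w = 0" using inj uw(3) by (simp add: z'_def)
      then show "x \<in> C z" using uw by simp
    qed
    moreover have "v \<in> C z" using v by (simp add: C_def)
    moreover have "v \<notin> C z'" using v vy n by (simp add: C_def z'_def br_simps)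
    ultimately have "C z' \<subset> C z" by blast
    then have "dim (C z') < dim (C z)" by (intro dim_psubset subC)
    then show False using least[OF z't] by simp
  qed
  then have "lie_centralizer br t = {x. br x z = 0}" using z by (auto simp: lie_centralizer_def)
  with z show thesis by (rule that)
qed

end

section \<open>One-parameter groups of automorphisms\<close>

context inner_space
begin

text \<open>
  Differentiation is tested against all vectors, in the absence of a topology on the vector space.
\<close>

definition weak_derivative :: "(real \<Rightarrow> 'a) \<Rightarrow> (real \<Rightarrow> 'a) \<Rightarrow> bool" where
  "weak_derivative f f' \<longleftrightarrow> (\<forall>t y. ((\<lambda>t. ip (f t) y) has_real_derivative ip (f' t) y) (at t))"

lemma weak_derivative_bilinear:
  fixes \<beta> :: "'a \<Rightarrow> 'a \<Rightarrow> real"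
  assumes \<beta>: "bilinear \<beta>" and f: "weak_derivative f f'" and g: "weak_derivative g g'"
  shows "((\<lambda>t. \<beta> (f t) (g t)) has_real_derivative \<beta> (f' t) (g t) + \<beta> (f t) (g' t)) (at t)"
proof -
  obtain E where E: "orthonormal E" "span E = UNIV" using orthonormal_basis[OF subspace_UNIV] .
  note ex = bilinear_expand[OF \<beta> E]
  have d: "((\<lambda>t. ip (f t) e) has_real_derivative ip (f' t) e) (at t)"
    "((\<lambda>t. ip (g t) e) has_real_derivative ip (g' t) e) (at t)" for e
    using f g by (auto simp: weak_derivative_def)
  have "((\<lambda>t. \<Sum>e\<in>E. \<Sum>k\<in>E. ip (f t) e * ip (g t) k * \<beta> e k) has_real_derivative
      (\<Sum>e\<in>E. \<Sum>k\<in>E. (ip (f' t) e * ip (g t) k + ip (g' t) k * ip (f t) e) * \<beta> e k)) (at t)"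
    by (intro DERIV_sum DERIV_cmult_right DERIV_mult d)
  moreover have "(\<Sum>e\<in>E. \<Sum>k\<in>E. (ip (f' t) e * ip (g t) k + ip (g' t) k * ip (f t) e) * \<beta> e k)
      = \<beta> (f' t) (g t) + \<beta> (f t) (g' t)"
    unfolding ex[of "f' t"] ex[of "f t"] by (simp add: sum.distrib algebra_simps)
  ultimately show ?thesis unfolding ex[of "f _"] by simp
qed

end

context compact_lie_algebra
begin

lemma bilinear_ip_br: "bilinear (\<lambda>a b. ip (br a b) v)"
  unfolding bilinear_def by (auto intro!: linearI simp: br_simps ip_simps)

text \<open>
  This is the uniqueness theorem for the linear differential equation given by \<open>ad w\<close>: since \<open>ad w\<close>
  is skew, the norm of a solution is constant.
\<close>

lemma weak_derivative_ad_0: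
  assumes f: "weak_derivative f (\<lambda>t. br w (f t))" and "f 0 = 0"
  shows "f t = 0"
proof -
  have "((\<lambda>t. ip (f t) (f t)) has_real_derivative 0) (at t)" for t
    using weak_derivative_bilinear[OF ip_bilinear f f, of t] ip_invariant[of w "f t" "f t"] by simp
  then have "ip (f t) (f t) = ip (f 0) (f 0)" by (intro DERIV_isconst_all) simp
  then show ?thesis using \<open>f 0 = 0\<close> by (simp add: ip_simps)
qed

lemma ad_square_symmetric:
  "linear (\<lambda>x. - br w (br w x))" "ip (- br w (br w x)) y = ip x (- br w (br w y))"
  by (auto intro!: linearI simp: br_simps ip_simps ip_invariant)

text \<open>
  The operator \<open>- (ad w)\<^sup>2\<close> is symmetric and positive semidefinite, since \<open>ad w\<close> is skew.
\<close>

lemma ad_square_eigenbasis: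
  obtains E \<mu> where "orthonormal E" "span E = UNIV" "\<And>e. \<mu> e \<ge> 0"
    "\<And>e. e \<in> E \<Longrightarrow> br w (br w e) = - ((\<mu> e * \<mu> e) *\<^sub>R e)"
    "\<And>e. e \<in> E \<Longrightarrow> \<mu> e = 0 \<Longrightarrow> br w e = 0"
proof -
  obtain E l where E: "orthonormal E" "span E = UNIV" and l: "\<And>e. e \<in> E \<Longrightarrow> - br w (br w e) = l e *\<^sub>R e"
    by (rule spectral_theorem[OF ad_square_symmetric]) blast
  have l_norm: "l e = ip (br w e) (br w e)" if "e \<in> E" for e
  proof -
    have "l e = ip (l e *\<^sub>R e) e" using E(1) that by (simp add: orthonormal_def ip_simps)
    also have "\<dots> = - ip (br w (br w e)) e" by (simp add: ip_simps flip: l[OF that])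
    finally show ?thesis using ip_invariant[of w "br w e" e] by simp
  qed
  define \<mu> where "\<mu> e = sqrt \<bar>l e\<bar>" for e
  have sq: "\<mu> e * \<mu> e = l e" if "e \<in> E" for e
    using l_norm[OF that] ip_nonneg[of "br w e"] by (simp add: \<mu>_def)
  show thesis
  proof (rule that[OF E, of \<mu>])
    show "\<mu> e \<ge> 0" for e by (simp add: \<mu>_def)
    show "br w (br w e) = - ((\<mu> e * \<mu> e) *\<^sub>R e)" if "e \<in> E" for e
      using l[OF that] sq[OF that] by (metis minus_minus)
    show "br w e = 0" if "e \<in> E" "\<mu> e = 0" for e
      using l_norm[OF that(1)] sq[OF that(1)] that(2) by simp
  qed
qed

definition fixing_automorphism :: "'g set \<Rightarrow> ('g \<Rightarrow> 'g) \<Rightarrow> bool" where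
  "fixing_automorphism F T \<longleftrightarrow> isometry T \<and> (\<forall>x y. T (br x y) = br (T x) (T y)) \<and> (\<forall>x\<in>F. T x = x)"

text \<open>
  \<open>T t\<close> is the exponential of \<open>t ad w\<close>. Instead of summing a series, it is written down in an
  eigenbasis of \<open>(ad w)\<^sup>2\<close>, where it consists of rotations in planes. That it respects the inner
  product, the bracket and the centralizer of \<open>w\<close> follows from uniqueness of solutions.
\<close>

lemma one_parameter_group:
  obtains T where "T 0 = (\<lambda>x. x)" "\<And>x. weak_derivative (\<lambda>t. T t x) (\<lambda>t. br w (T t x))"
    "\<And>t. fixing_automorphism {x. br w x = 0} (T t)"
proof -
  obtain E \<mu> where E: "orthonormal E" "span E = UNIV" and \<mu>: "\<And>e. \<mu> e \<ge> 0"
    and eig: "\<And>e. e \<in> E \<Longrightarrow> br w (br w e) = - ((\<mu> e * \<mu> e) *\<^sub>R e)"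
    and ker: "\<And>e. e \<in> E \<Longrightarrow> \<mu> e = 0 \<Longrightarrow> br w e = 0"
    by (rule ad_square_eigenbasis) blast
  \<comment> \<open>For \<open>\<mu> e = 0\<close> the quotient is \<open>0\<close> by convention, which is harmless because \<open>br w e = 0\<close>.\<close>
  define T where "T t x = (\<Sum>e\<in>E. ip x e *\<^sub>R (cos (\<mu> e * t) *\<^sub>R e + (sin (\<mu> e * t) / \<mu> e) *\<^sub>R br w e))" for t x
  have T0: "T 0 = (\<lambda>x. x)"
  proof
    fix x
    have "T 0 x = proj E x" by (simp add: T_def proj_def)
    then show "T 0 x = x" using proj_id[OF E(1)] E(2) by simp
  qed
  have lin: "linear (T t)" for t
    unfolding T_def by (rule linearI) (simp_all add: ip_simps scaleR_add_left sum.distrib scaleR_sum_right)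
  have linw: "linear (br w)" using bilinear_br by (simp add: bilinear_def)
  have wd: "weak_derivative (\<lambda>t. T t x) (\<lambda>t. br w (T t x))" for x
    unfolding weak_derivative_def
  proof (intro allI)
    fix t y
    have summand: "((\<lambda>t. ip (cos (\<mu> e * t) *\<^sub>R e + (sin (\<mu> e * t) / \<mu> e) *\<^sub>R br w e) y) has_real_derivative
        ip (br w (cos (\<mu> e * t) *\<^sub>R e + (sin (\<mu> e * t) / \<mu> e) *\<^sub>R br w e)) y) (at t)" if e: "e \<in> E" for e
    proof (cases "\<mu> e = 0")
      case True
      then show ?thesis using ker[OF e] by (simp add: ip_simps br_simps)
    next
      case False
      have "((\<lambda>t. cos (\<mu> e * t) * ip e y + (sin (\<mu> e * t) / \<mu> e) * ip (br w e) y) has_real_derivative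
          - (\<mu> e * sin (\<mu> e * t)) * ip e y + cos (\<mu> e * t) * ip (br w e) y) (at t)"
        by (auto intro!: derivative_eq_intros simp: False)
      then show ?thesis using False by (simp add: ip_simps br_simps eig[OF e] algebra_simps)
    qed
    have "((\<lambda>t. \<Sum>e\<in>E. ip x e * ip (cos (\<mu> e * t) *\<^sub>R e + (sin (\<mu> e * t) / \<mu> e) *\<^sub>R br w e) y)
        has_real_derivative (\<Sum>e\<in>E. ip x e *
          ip (br w (cos (\<mu> e * t) *\<^sub>R e + (sin (\<mu> e * t) / \<mu> e) *\<^sub>R br w e)) y)) (at t)"
      by (intro DERIV_sum DERIV_cmult summand)
    then show "((\<lambda>t. ip (T t x) y) has_real_derivative ip (br w (T t x)) y) (at t)"
      unfolding T_def linear_sum[OF linw] linear_scale[OF linw] ip_sum_left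
      by (simp add: ip_simps(3))
  qed
  have iso: "ip (T t x) (T t y) = ip x y" for t x y
  proof -
    have "((\<lambda>t. ip (T t x) (T t y)) has_real_derivative 0) (at t)" for t
      using weak_derivative_bilinear[OF ip_bilinear wd wd, of x y t] ip_invariant[of w "T t x" "T t y"] by simp
    then have "ip (T t x) (T t y) = ip (T 0 x) (T 0 y)" by (intro DERIV_isconst_all) simp
    then show ?thesis by (simp add: T0)
  qed
  have aut: "T t (br x y) = br (T t x) (T t y)" for t x y
  proof -
    define f where "f t = T t (br x y) - br (T t x) (T t y)" for t
    have "weak_derivative f (\<lambda>t. br w (f t))"
      unfolding weak_derivative_def
    proof (intro allI)
      fix t v
      have 1: "((\<lambda>t. ip (T t (br x y)) v) has_real_derivative ip (br w (T t (br x y))) v) (at t)"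
        using wd[of "br x y"] by (auto simp: weak_derivative_def)
      have "((\<lambda>t. ip (f t) v) has_real_derivative ip (br w (T t (br x y))) v -
          (ip (br (br w (T t x)) (T t y)) v + ip (br (T t x) (br w (T t y))) v)) (at t)"
        unfolding f_def ip_simps
        by (intro DERIV_diff 1 weak_derivative_bilinear[OF bilinear_ip_br wd wd])
      then show "((\<lambda>t. ip (f t) v) has_real_derivative ip (br w (f t)) v) (at t)"
        by (simp add: f_def br_simps ip_simps br_br_left)
    qed
    then have "f t = 0" by (rule weak_derivative_ad_0) (simp add: f_def T0)
    then show ?thesis by (simp add: f_def)
  qed
  have fix_ker: "T t x = x" if x: "br w x = 0" for t x
  proof -
    have "weak_derivative (\<lambda>t. T t x - x) (\<lambda>t. br w (T t x - x))"
      unfolding weak_derivative_def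
    proof (intro allI)
      fix t v
      have "((\<lambda>t. ip (T t x) v - ip x v) has_real_derivative ip (br w (T t x)) v - 0) (at t)"
        using wd[of x] by (intro DERIV_diff DERIV_const) (auto simp: weak_derivative_def)
      then show "((\<lambda>t. ip (T t x - x) v) has_real_derivative ip (br w (T t x - x)) v) (at t)"
        by (simp add: ip_simps br_simps x)
    qed
    then have "T t x - x = 0" by (rule weak_derivative_ad_0) (simp add: T0)
    then show ?thesis by simp
  qed
  show thesis
    by (rule that[of T]) (use T0 wd lin iso aut fix_ker in \<open>auto simp: fixing_automorphism_def isometry_def\<close>)
qed

end

section \<open>Conjugating elements into commuting position\<close>

context compact_lie_algebra
begin

text \<open>
  The conditions on an automorphism are closed conditions on its matrix, and the matrix entries of an
  isometry are at most 1 in absolute value.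
\<close>

lemma fixing_automorphism_maximum:
  obtains T where "fixing_automorphism F T"
    "\<And>T'. fixing_automorphism F T' \<Longrightarrow> ip (T' b) a \<le> ip (T b) a"
proof -
  obtain E where E: "orthonormal E" "span E = UNIV" using orthonormal_basis[OF subspace_UNIV] .
  define M where "M c x = (\<Sum>e\<in>E. \<Sum>f\<in>E. (ip x e * c (e, f)) *\<^sub>R f)" for c :: "'g \<times> 'g \<Rightarrow> real" and x
  define Box where "Box = {c :: 'g \<times> 'g \<Rightarrow> real. \<forall>i. if i \<in> E \<times> E then \<bar>c i\<bar> \<le> 1 else c i = 0}"
  define K where "K = Box \<inter> {c. fixing_automorphism F (M c)}"
  have lin: "linear (M c)" for c
    unfolding M_def by (rule linearI) (simp_all add: ip_simps scaleR_add_left distrib_right sum.distrib scaleR_sum_right mult.assoc)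
  have cont: "continuous_on UNIV (\<lambda>c. ip (M c x) v)" for x v
  proof -
    have "ip (M c x) v = (\<Sum>e\<in>E. \<Sum>f\<in>E. (ip x e * c (e, f)) * ip f v)" for c
      unfolding M_def by (simp add: ip_sum_left ip_simps)
    then show ?thesis
      by (simp add: continuous_on_sum continuous_on_mult continuous_on_const continuous_on_product_coordinates)
  qed
  have cont2: "continuous_on UNIV (\<lambda>c. \<beta> (M c x) (M c y))" if "bilinear \<beta>" for \<beta> :: "'g \<Rightarrow> 'g \<Rightarrow> real" and x y
  proof -
    have "\<beta> (M c x) (M c y) = (\<Sum>e\<in>E. \<Sum>f\<in>E. ip (M c x) e * ip (M c y) f * \<beta> e f)" for c
      by (rule bilinear_expand[OF that E])
    then show ?thesis by (simp add: cont continuous_on_sum continuous_on_mult continuous_on_const)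
  qed
  have "{c. fixing_automorphism F (M c)} =
      (\<Inter>x. \<Inter>y. {c. ip (M c x) (M c y) = ip x y}) \<inter>
      (\<Inter>x. \<Inter>y. \<Inter>v. {c. ip (M c (br x y)) v = ip (br (M c x) (M c y)) v}) \<inter>
      (\<Inter>x\<in>F. \<Inter>v. {c. ip (M c x) v = ip x v})"
    unfolding fixing_automorphism_def isometry_def using lin by (auto intro: ip_ext)
  moreover have "closed \<dots>"
    by (intro closed_Int closed_INT ballI closed_Collect_eq cont cont2 bilinear_ip_br ip_bilinear continuous_on_const)
  ultimately have "closed {c. fixing_automorphism F (M c)}" by simp
  then have "compact K" unfolding K_def Box_def by (intro compact_Int_closed compact_coordinate_box)
  have coord: "\<exists>c\<in>K. M c = T" if T: "fixing_automorphism F T" for T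
  proof -
    have linT: "linear T" and iso: "\<And>x y. ip (T x) (T y) = ip x y"
      using T by (auto simp: fixing_automorphism_def isometry_def)
    define c where "c i = (if i \<in> E \<times> E then ip (T (fst i)) (snd i) else 0)" for i
    have "M c x = T x" for x
    proof -
      have "M c x = (\<Sum>e\<in>E. ip x e *\<^sub>R proj E (T e))"
        unfolding M_def proj_def scaleR_sum_right by (intro sum.cong refl) (simp add: c_def)
      also have "\<dots> = T (proj E x)"
        using proj_id[OF E(1)] E(2) unfolding proj_def[of E x] by (simp add: linear_sum[OF linT] linear_scale[OF linT])
      finally show ?thesis using proj_id[OF E(1)] E(2) by simp
    qed
    then have Mc: "M c = T" ..
    have "\<bar>ip (T e) f\<bar> \<le> 1" if "e \<in> E" "f \<in> E" for e f
    proof -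
      have 1: "ip (T e) (T e) = 1" "ip f f = 1" using iso E(1) that by (simp_all add: orthonormal_def)
      have "ip (T e - f) (T e - f) \<ge> 0" "ip (T e + f) (T e + f) \<ge> 0" by (rule ip_nonneg)+
      then show ?thesis using 1 ip_sym[of f "T e"] by (simp add: ip_simps abs_le_iff)
    qed
    then have "c \<in> Box" by (auto simp: Box_def c_def)
    then show ?thesis using Mc T by (auto simp: K_def)
  qed
  have "fixing_automorphism F (\<lambda>x. x)"
    using linear_ident by (simp add: fixing_automorphism_def isometry_def)
  then have "K \<noteq> {}" using coord by blast
  moreover have "continuous_on K (\<lambda>c. ip (M c b) a)" using cont by (rule continuous_on_subset) simp
  ultimately obtain c where c: "c \<in> K" "\<And>d. d \<in> K \<Longrightarrow> ip (M d b) a \<le> ip (M c b) a"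
    using continuous_attains_sup[OF \<open>compact K\<close>] by blast
  show thesis
  proof (rule that)
    show "fixing_automorphism F (M c)" using c(1) by (simp add: K_def)
    show "ip (T' b) a \<le> ip (M c b) a" if T': "fixing_automorphism F T'" for T'
      using coord[OF T'] c(2) by blast
  qed
qed

text \<open>
  Move \<open>b\<close> as close to \<open>a\<close> as automorphisms fixing \<open>F\<close> allow. The element \<open>w = [T b, a]\<close> commutes
  with \<open>F\<close>, so its one-parameter group may be composed with \<open>T\<close>, and the derivative of the inner
  product along it is the square of the length of \<open>w\<close>. This is the classical argument for the
  conjugacy of maximal tori.
\<close>

lemma conjugate_to_commute:
  assumes a: "\<And>x. x \<in> F \<Longrightarrow> br a x = 0" and b: "\<And>x. x \<in> F \<Longrightarrow> br b x = 0"
  obtains T where "fixing_automorphism F T" "br (T b) a = 0"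
proof -
  obtain T where T: "fixing_automorphism F T"
    and max: "\<And>T'. fixing_automorphism F T' \<Longrightarrow> ip (T' b) a \<le> ip (T b) a"
    by (rule fixing_automorphism_maximum[of F b a]) blast
  define w where "w = br (T b) a"
  obtain S where S0: "S 0 = (\<lambda>x. x)" and wd: "\<And>x. weak_derivative (\<lambda>t. S t x) (\<lambda>t. br w (S t x))"
    and S: "\<And>t. fixing_automorphism {x. br w x = 0} (S t)"
    by (rule one_parameter_group) blast
  have Tb: "br (T b) x = 0" if x: "x \<in> F" for x
  proof -
    have "br (T b) x = T (br b x)" using T x by (simp add: fixing_automorphism_def)
    also have "\<dots> = 0" using b[OF x] T by (simp add: fixing_automorphism_def isometry_def linear_0)
    finally show ?thesis .
  qed
  have "br w x = 0" if x: "x \<in> F" for x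
    using br_br_left[of "T b" a x] a[OF x] Tb[OF x] by (simp add: w_def br_simps)
  then have ST: "fixing_automorphism F (\<lambda>x. S t (T x))" for t
    using S[of t] T isometry_comp[of "S t" T] by (auto simp: fixing_automorphism_def)
  have "((\<lambda>t. ip (S t (T b)) a) has_real_derivative ip (br w (T b)) a) (at 0)"
    using wd[of "T b"] S0 unfolding weak_derivative_def by metis
  moreover have "\<forall>t. \<bar>0 - t\<bar> < 1 \<longrightarrow> ip (S t (T b)) a \<le> ip (S 0 (T b)) a"
    using max[OF ST] by (simp add: S0)
  ultimately have "ip (br w (T b)) a = 0" by (intro DERIV_local_max[of _ _ 0 1]) auto
  moreover have "ip (br w (T b)) a = ip w w"
    using br_commute[of w "T b"] ip_invariant[of "T b" w a] by (simp add: ip_simps w_def)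
  ultimately have "w = 0" by simp
  then show thesis using that T by (simp add: w_def)
qed

end

section \<open>A centralizer containing the subalgebra\<close>

context compact_lie_algebra
begin

lemma derived_subset: "lie_subalgebra br h \<Longrightarrow> derived_subalgebra br h \<subseteq> h"
  unfolding derived_subalgebra_def lie_subalgebra_def by (intro span_minimal) auto

lemma br_in_derived: "x \<in> h \<Longrightarrow> y \<in> h \<Longrightarrow> br x y \<in> derived_subalgebra br h"
  unfolding derived_subalgebra_def by (intro span_base) blast

lemma subspace_derived: "subspace (derived_subalgebra br h)"
  unfolding derived_subalgebra_def by simp

text \<open>
  This is the orthogonal splitting of a Lie algebra with invariant inner product into its derived
  algebra and its center.
\<close>

lemma derived_perp_central:
  assumes h: "lie_subalgebra br h" and x: "x \<in> h" "x \<in> perp (derived_subalgebra br h)" and y: "y \<in> h"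
  shows "br x y = 0"
proof -
  have "br x y \<in> h" using h x y by (simp add: lie_subalgebra_def)
  then have "br y (br x y) \<in> derived_subalgebra br h" using y by (intro br_in_derived)
  then have "ip x (br y (br x y)) = 0" using x(2) by (simp add: perp_def)
  then have "ip (br x y) (br x y) = 0"
    using br_commute[of x y] ip_invariant[of y x "br x y"] by (simp add: ip_simps)
  then show ?thesis by simp
qed

text \<open>
  The centralizer of \<open>t\<close> itself need not contain \<open>h\<close>: if both derived algebras vanish, for instance,
  it may be any maximal abelian subalgebra, and \<open>h\<close> may lie in a different one.
\<close>

lemma centralizer_containing_subalgebra:
  assumes h: "lie_subalgebra br h" and t: "abelian_subalgebra br t"
    and der: "derived_subalgebra br (lie_centralizer br t) = derived_subalgebra br h"
  obtains z where "h \<subseteq> {x. br x z = 0}" "\<And>x y. br x z = 0 \<Longrightarrow> br y z = 0 \<Longrightarrow> br x y \<in> h"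
proof -
  define s where "s = derived_subalgebra br h"
  have sub: "subspace h" and subs: "subspace s" and sh: "s \<subseteq> h"
    using h derived_subset[OF h] subspace_derived by (auto simp: lie_subalgebra_def s_def)
  obtain z where z: "z \<in> t" "lie_centralizer br t = {x. br x z = 0}" using generic_element[OF t] .
  define c where "c = h \<inter> perp s"
  have central: "br x y = 0" if "x \<in> c" "y \<in> h" for x y
    using derived_perp_central[OF h _ _ that(2)] that(1) by (simp add: c_def s_def)
  have "abelian_subalgebra br c"
    unfolding abelian_subalgebra_def lie_subalgebra_def
    using subspace_inter[OF sub subspace_perp] central subspace_0 by (auto simp: c_def)
  then obtain a where a: "a \<in> c" "lie_centralizer br c = {x. br x a = 0}" using generic_element by blast
  have "lie_subalgebra br {x. br x z = 0}"
    unfolding lie_subalgebra_def using subspace_kernel by (auto simp: br_br_left br_simps)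
  then have "derived_subalgebra br {x. br x z = 0} \<subseteq> {x. br x z = 0}" by (rule derived_subset)
  then have sz: "br x z = 0" if "x \<in> s" for x using that der z(2) by (auto simp: s_def)
  obtain T where T: "fixing_automorphism s T" and Ta: "br (T z) a = 0"
  proof (rule conjugate_to_commute[of s a z])
    show "br a x = 0" if "x \<in> s" for x using central[OF a(1)] that sh by blast
    show "br z x = 0" if "x \<in> s" for x using sz[OF that] br_eq_0_commute by blast
  qed
  have linT: "linear T" and T_br: "\<And>x y. T (br x y) = br (T x) (T y)" and T_s: "\<And>x. x \<in> s \<Longrightarrow> T x = x"
    and bijT: "bij T"
    using T isometry_bij by (auto simp: fixing_automorphism_def isometry_def)
  have Tz: "br (T x) (T z) = 0 \<longleftrightarrow> br x z = 0" for x
    using T_br linear_0[OF linT] bijT by (metis bij_def inj_eq)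
  show thesis
  proof (rule that[of "T z"])
    show "h \<subseteq> {x. br x (T z) = 0}"
    proof
      fix x assume x: "x \<in> h"
      obtain u v where uv: "x = u + v" "u \<in> s" "v \<in> perp s" using perp_decompose[OF subs] .
      have "x - u \<in> h" using x uv(2) sh sub by (blast intro: subspace_diff)
      then have "v \<in> c" using uv by (simp add: c_def)
      moreover have "T z \<in> lie_centralizer br c" using Ta a(2) by simp
      ultimately have "br (T z) v = 0" by (simp add: lie_centralizer_def)
      then have "br v (T z) = 0" using br_eq_0_commute by blast
      moreover have "br u (T z) = 0" using Tz[of u] T_s[OF uv(2)] sz[OF uv(2)] by simp
      ultimately show "x \<in> {x. br x (T z) = 0}" using uv(1) by (simp add: br_simps)
    qed
    show "br x y \<in> h" if x: "br x (T z) = 0" and y: "br y (T z) = 0" for x y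
    proof -
      obtain x0 y0 where 0: "x = T x0" "y = T y0" using bijT by (metis bij_pointE)
      have "x0 \<in> lie_centralizer br t" "y0 \<in> lie_centralizer br t" using x y Tz 0 z(2) by auto
      then have "br x0 y0 \<in> s" using br_in_derived der by (metis s_def)
      then have "br x y = br x0 y0" using T_s T_br 0 by metis
      then show ?thesis using \<open>br x0 y0 \<in> s\<close> sh by auto
    qed
  qed
qed

end

section \<open>Construction of an integrable structure\<close>

context compact_lie_algebra
begin

text \<open>
  \<open>k\<close> is the orthogonal factor in the polar decomposition of \<open>ad z\<close>, extended by zero to the
  centralizer \<open>m\<close>. The crucial last two claims say that the elements \<open>x + i k x\<close> with \<open>x\<close>
  orthogonal to \<open>m\<close> form a subalgebra \<open>Q\<close> of the complexification. It is the sum of the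
  eigenspaces \<open>W \<nu>\<close> of \<open>ad z\<close> for the eigenvalues \<open>- i \<nu>\<close> with \<open>\<nu> > 0\<close>, and brackets add
  eigenvalues.
\<close>

lemma ad_polar:
  assumes m_def: "m = {x. br x z = 0}"
  obtains k where "linear k" "\<And>x. x \<in> m \<Longrightarrow> k x = 0" "\<And>x. k x \<in> perp m"
    "\<And>x. x \<in> perp m \<Longrightarrow> k (k x) = - x"
    "\<And>u x. u \<in> m \<Longrightarrow> x \<in> perp m \<Longrightarrow> k (br u x) = br u (k x)"
    "\<And>x y. x \<in> perp m \<Longrightarrow> y \<in> perp m \<Longrightarrow> br x y - br (k x) (k y) \<in> perp m"
    "\<And>x y. x \<in> perp m \<Longrightarrow> y \<in> perp m \<Longrightarrow> br (k x) y + br x (k y) = k (br x y - br (k x) (k y))"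
proof -
  have subP: "subspace (perp m)" by (rule subspace_perp)
  obtain E \<mu> where E: "orthonormal E" "span E = UNIV" and \<mu>: "\<And>e. \<mu> e \<ge> 0"
    and eig: "\<And>e. e \<in> E \<Longrightarrow> br z (br z e) = - ((\<mu> e * \<mu> e) *\<^sub>R e)"
    and ker: "\<And>e. e \<in> E \<Longrightarrow> \<mu> e = 0 \<Longrightarrow> br z e = 0"
    by (rule ad_square_eigenbasis) blast
  \<comment> \<open>Summands with \<open>\<mu> e = 0\<close> vanish.\<close>
  define k where "k x = (\<Sum>e\<in>E. (ip x e / \<mu> e) *\<^sub>R br z e)" for x
  have lin: "linear k"
    unfolding k_def by (rule linearI) (simp_all add: ip_simps scaleR_add_left add_divide_distrib sum.distrib scaleR_sum_right)
  have linz: "linear (br u)" "linear (\<lambda>x. br x u)" for u using bilinear_br by (simp_all add: bilinear_def)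
  have range_perp: "br z x \<in> perp m" for x
  proof -
    have "ip (br z x) y = 0" if "br y z = 0" for y
    proof -
      have "br z y = 0" using that br_eq_0_commute by blast
      then show ?thesis using ip_invariant[of z x y] by (simp add: ip_simps)
    qed
    then show ?thesis by (simp add: perp_def m_def)
  qed
  define W where "W \<nu> = {a. br z (fst a) = \<nu> *\<^sub>R snd a \<and> br z (snd a) = - (\<nu> *\<^sub>R fst a)}" for \<nu> :: real
  have W: "snd a = k (fst a) \<and> fst a \<in> perp m \<and> snd a \<in> perp m" if a: "a \<in> W \<nu>" and pos: "\<nu> > 0" for a \<nu>
  proof -
    define p r where "p = fst a" and "r = snd a"
    have zp: "br z p = \<nu> *\<^sub>R r" and zr: "br z r = - (\<nu> *\<^sub>R p)" using a by (simp_all add: W_def p_def r_def)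
    have zzp: "br z (br z p) = - ((\<nu> * \<nu>) *\<^sub>R p)" by (simp add: zp zr br_simps)
    \<comment> \<open>As \<open>p\<close> is an eigenvector of \<open>(ad z)\<^sup>2\<close>, only basis vectors with \<open>\<mu> e = \<nu>\<close> occur in it.\<close>
    have coef: "(ip p e / \<mu> e) *\<^sub>R br z e = (1 / \<nu>) *\<^sub>R (ip p e *\<^sub>R br z e)" if e: "e \<in> E" for e
    proof (cases "ip p e = 0")
      case False
      have "ip (br z (br z p)) e = ip p (br z (br z e))" using ip_invariant by simp
      then have "\<nu> * \<nu> * ip p e = \<mu> e * \<mu> e * ip p e" by (simp add: zzp eig[OF e] ip_simps)
      then have "\<nu>\<^sup>2 = (\<mu> e)\<^sup>2" using False by (simp add: power2_eq_square)
      then have "\<nu> = \<mu> e" using pos \<mu>[of e] by (simp add: power2_eq_iff_nonneg)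
      then show ?thesis by simp
    qed simp
    have "k p = (1 / \<nu>) *\<^sub>R br z (proj E p)"
      unfolding k_def proj_def linear_sum[OF linz(1)] linear_scale[OF linz(1)] scaleR_sum_right
      by (intro sum.cong refl coef)
    then have "k p = r" using proj_id[OF E(1)] E(2) zp pos by simp
    moreover have "p = (- 1 / \<nu>) *\<^sub>R br z r" "r = (1 / \<nu>) *\<^sub>R br z p" using zp zr pos by simp_all
    then have "p \<in> perp m" "r \<in> perp m" using range_perp subspace_scale[OF subP] by metis+
    ultimately show ?thesis by (simp add: p_def r_def)
  qed
  define E' where "E' = {e \<in> E. \<mu> e \<noteq> 0}"
  have k_e: "k e = (1 / \<mu> e) *\<^sub>R br z e" if e: "e \<in> E" for e
  proof -
    have "k e = (\<Sum>f\<in>E. if f = e then (1 / \<mu> e) *\<^sub>R br z e else 0)"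
      unfolding k_def using E(1) e by (intro sum.cong refl) (auto simp: orthonormal_def)
    then show ?thesis using e orthonormal_finite[OF E(1)] by simp
  qed
  have eW: "(e, k e) \<in> W (\<mu> e)" and pos: "\<mu> e > 0" if "e \<in> E'" for e
    using that \<mu>[of e] eig[of e] by (auto simp: W_def E'_def k_e br_simps)
  have E'_perp: "e \<in> perp m" if "e \<in> E'" for e using W[OF eW[OF that] pos[OF that]] by simp
  have span_E': "x \<in> span E'" if x: "x \<in> perp m" for x
  proof -
    have "x = proj E x" using proj_id[OF E(1)] E(2) by simp
    also have "\<dots> = (\<Sum>e\<in>E'. ip x e *\<^sub>R e)"
      unfolding proj_def
    proof (rule sum.mono_neutral_right)
      show "\<forall>e\<in>E - E'. ip x e *\<^sub>R e = 0"
        using x ker br_eq_0_commute by (auto simp: E'_def perp_def m_def)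
    qed (auto simp: E'_def orthonormal_finite[OF E(1)])
    also have "\<dots> \<in> span E'" by (intro span_sum span_scale span_base)
    finally show ?thesis .
  qed
  have k_m: "k x = 0" if "x \<in> m" for x
    unfolding k_def
  proof (rule sum.neutral, rule ballI)
    fix e assume e: "e \<in> E"
    show "(ip x e / \<mu> e) *\<^sub>R br z e = 0"
    proof (cases "e \<in> E'")
      case True
      then have "ip x e = 0" using E'_perp[OF True] that ip_sym[of x e] by (simp add: perp_def)
      then show ?thesis by simp
    qed (use e ker in \<open>auto simp: E'_def\<close>)
  qed
  have k_perp: "k x \<in> perp m" for x
    unfolding k_def using subP range_perp by (intro subspace_sum subspace_scale)
  have k_k: "k (k x) = - x" if "x \<in> perp m" for x
  proof (rule linear_eq_on_span[of "\<lambda>x. k (k x)" uminus E'])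
    show "linear (\<lambda>x. k (k x))" using linear_compose[OF lin lin] by (simp add: o_def)
    show "linear (uminus :: 'g \<Rightarrow> 'g)" by (rule linearI) auto
    show "x \<in> span E'" using span_E'[OF that] .
    show "k (k e) = - e" if e: "e \<in> E'" for e
    proof -
      have "(k e, - e) \<in> W (\<mu> e)" using eW[OF e] by (simp add: W_def br_simps)
      then show ?thesis using W pos[OF e] by fastforce
    qed
  qed
  have k_br: "k (br u x) = br u (k x)" if u: "br u z = 0" and x: "x \<in> perp m" for u x
  proof (rule linear_eq_on_span[of "\<lambda>x. k (br u x)" "\<lambda>x. br u (k x)" E'])
    show "linear (\<lambda>x. k (br u x))" "linear (\<lambda>x. br u (k x))"
      using linear_compose[OF linz(1) lin] linear_compose[OF lin linz(1)] by (simp_all add: o_def)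
    show "x \<in> span E'" using span_E'[OF x] .
    show "k (br u e) = br u (k e)" if e: "e \<in> E'" for e
    proof -
      have "br z (br u y) = br u (br z y)" for y
        using br_left_commute[of z u y] u br_eq_0_commute by blast
      then have "(br u e, br u (k e)) \<in> W (\<mu> e)" using eW[OF e] by (simp add: W_def br_simps)
      then show ?thesis using W pos[OF e] by fastforce
    qed
  qed
  have W_cbr: "cbr a b \<in> W (\<nu> + \<rho>)" if "a \<in> W \<nu>" "b \<in> W \<rho>" for a b \<nu> \<rho>
  proof -
    have der: "br z (br x y) = br (br z x) y + br x (br z y)" for x y
      using br_br_left[of z x y] by simp
    show ?thesis using that by (simp add: W_def cbr_def der br_simps algebra_simps)
  qed
  define Q where "Q = {a. fst a \<in> perp m \<and> snd a = k (fst a)}"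
  have subQ: "subspace Q"
    using subP by (auto simp: Q_def subspace_def linear_0[OF lin] linear_add[OF lin] linear_scale[OF lin])
  have Q: "cbr (x, k x) (y, k y) \<in> Q" if x: "x \<in> perp m" and y: "y \<in> perp m" for x y
  proof -
    have lp: "linear (\<lambda>x. (x, k x))" using lin by (simp add: linear_iff)
    have lc: "linear (cbr a)" "linear (\<lambda>a. cbr a b)" for a b
      using bilinear_cbr unfolding bilinear_def by blast+
    have "cbr (e, k e) (f, k f) \<in> Q" if "e \<in> E'" "f \<in> E'" for e f
      using W[OF W_cbr[OF eW[OF that(1)] eW[OF that(2)]]] pos that by (simp add: Q_def add_pos_pos)
    moreover have "subspace ((\<lambda>y. cbr (e, k e) (y, k y)) -` Q)" for e
      using linear_subspace_vimage[OF linear_compose[OF lp lc(1)] subQ] by (simp add: o_def)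
    ultimately have 1: "cbr (e, k e) (y, k y) \<in> Q" if "e \<in> E'" for e
      using span_minimal[of E' "(\<lambda>y. cbr (e, k e) (y, k y)) -` Q"] span_E'[OF y] that by blast
    have "subspace ((\<lambda>x. cbr (x, k x) (y, k y)) -` Q)"
      using linear_subspace_vimage[OF linear_compose[OF lp lc(2)] subQ] by (simp add: o_def)
    with 1 show ?thesis
      using span_minimal[of E' "(\<lambda>x. cbr (x, k x) (y, k y)) -` Q"] span_E'[OF x] by blast
  qed
  show thesis
  proof (rule that[OF lin k_m k_perp k_k])
    show "k (br u x) = br u (k x)" if "u \<in> m" "x \<in> perp m" for u x
      using k_br that by (simp add: m_def)
    show "br x y - br (k x) (k y) \<in> perp m"
      and "br (k x) y + br x (k y) = k (br x y - br (k x) (k y))"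
      if "x \<in> perp m" "y \<in> perp m" for x y
      using Q[OF that] by (simp_all add: Q_def cbr_def)
  qed
qed

text \<open>
  Use \<open>ad_polar\<close> on the complement of \<open>m\<close> and any complex structure \<open>c\<close> on the complement \<open>l\<close> of
  \<open>h\<close> in \<open>m\<close>. The value \<open>N x y\<close> is then checked separately on the two summands: on \<open>m\<close> all brackets
  fall into \<open>h\<close>; for \<open>x\<close> in \<open>m\<close> and \<open>y\<close> orthogonal to \<open>m\<close> the terms cancel because \<open>ad x\<close>
  commutes with \<open>k\<close>; and on the complement of \<open>m\<close> the subalgebra property of \<open>ad_polar\<close> applies.
\<close>

lemma integrable_structure_exists:
  assumes h: "lie_subalgebra br h" and even: "even (dim (UNIV :: 'g set) - dim h)"
    and hm: "h \<subseteq> {x. br x z = 0}" and mm: "\<And>x y. br x z = 0 \<Longrightarrow> br y z = 0 \<Longrightarrow> br x y \<in> h"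
  shows "\<exists>J. invariant_complex_structure br h J \<and> integrable_structure br h J"
proof -
  define m where "m = {x. br x z = 0}"
  have subh: "subspace h" and subm: "subspace m"
    using h subspace_kernel by (auto simp: lie_subalgebra_def m_def)
  have hm': "h \<subseteq> m" using hm by (simp add: m_def)
  have mm': "br x y \<in> h" if "x \<in> m" "y \<in> m" for x y using mm that by (simp add: m_def)
  obtain k where k: "linear k" "\<And>x. x \<in> m \<Longrightarrow> k x = 0" "\<And>x. k x \<in> perp m"
      "\<And>x. x \<in> perp m \<Longrightarrow> k (k x) = - x"
      "\<And>u x. u \<in> m \<Longrightarrow> x \<in> perp m \<Longrightarrow> k (br u x) = br u (k x)"
      "\<And>x y. x \<in> perp m \<Longrightarrow> y \<in> perp m \<Longrightarrow> br x y - br (k x) (k y) \<in> perp m"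
      "\<And>x y. x \<in> perp m \<Longrightarrow> y \<in> perp m \<Longrightarrow> br (k x) y + br x (k y) = k (br x y - br (k x) (k y))"
    by (rule ad_polar[OF m_def]) blast
  define l where "l = m \<inter> perp h"
  have subl: "subspace l" unfolding l_def by (rule subspace_inter[OF subm subspace_perp])
  have "dim (UNIV :: 'g set) = dim m + dim (perp m)" using dim_perp[OF subm subspace_UNIV] by simp
  moreover have "dim m = dim h + dim l" unfolding l_def using dim_perp[OF subh subm hm'] .
  moreover have "even (dim (perp m))"
    by (rule even_dim_complex_structure[OF subspace_perp k(1) k(3) k(4)])
  ultimately have "even (dim l)" using even by simp
  then obtain c where c: "linear c" "\<And>x. c x \<in> l" "\<And>x. x \<in> l \<Longrightarrow> c (c x) = - x" "\<And>x. x \<in> perp l \<Longrightarrow> c x = 0"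
    using complex_structure_exists[OF subl] by blast
  have l_m: "x \<in> m" if "x \<in> l" for x using that by (simp add: l_def)
  have c_h: "c x = 0" if "x \<in> h" for x
    using that ip_sym[of x] by (intro c(4)) (auto simp: l_def perp_def)
  have c_perp: "c x = 0" if "x \<in> perp m" for x
    using that by (intro c(4)) (auto simp: l_def perp_def)
  define j where "j x = k x + c x" for x
  have linj: "linear j" unfolding j_def using k(1) c(1) by (rule linear_compose_add)
  have j_m: "j x = c x" if "x \<in> m" for x using k(2)[OF that] by (simp add: j_def)
  have j_perp: "j x = k x" if "x \<in> perp m" for x using c_perp[OF that] by (simp add: j_def)
  have j_h: "j x = 0" if "x \<in> h" for x using that hm' j_m c_h by auto
  have m_perp: "br u x \<in> perp m" if "u \<in> m" "x \<in> perp m" for u x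
  proof -
    have "br u v \<in> m" if "v \<in> m" for v using mm'[OF \<open>u \<in> m\<close> that] hm' by blast
    then show ?thesis using that by (auto simp: perp_def ip_invariant)
  qed
  have split: "\<exists>u w. x = u + w \<and> u \<in> m \<and> w \<in> perp m" for x
    using perp_decompose[OF subm] by metis
  have jj: "j (j x) + x \<in> h" for x
  proof -
    obtain u w where x: "x = u + w" "u \<in> m" "w \<in> perp m" using split by blast
    obtain a v where u: "u = a + v" "a \<in> h" "v \<in> perp h" using perp_decompose[OF subh] .
    have "u - a \<in> m" using x(2) u(2) hm' subm by (blast intro: subspace_diff)
    then have v: "v \<in> l" using u by (simp add: l_def)
    have "j x = c v + k w"
      unfolding x u linear_add[OF linj] using j_h[OF u(2)] j_m[OF l_m[OF v]] j_perp[OF x(3)] by simp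
    then have "j (j x) = c (c v) + k (k w)"
      using linear_add[OF linj] j_m[OF l_m[OF c(2)]] j_perp[OF k(3)] by simp
    then show ?thesis using c(3)[OF v] k(4)[OF x(3)] u(2) by (simp add: x u)
  qed
  have jinv: "j (br a x) - br a (j x) \<in> h" if a: "a \<in> h" for a x
  proof -
    obtain u w where x: "x = u + w" "u \<in> m" "w \<in> perp m" using split by blast
    have am: "a \<in> m" using a hm' by blast
    have "j (br a x) = br a (k w)"
      unfolding x br_simps linear_add[OF linj]
      using j_h[OF mm'[OF am x(2)]] j_perp[OF m_perp[OF am x(3)]] k(5)[OF am x(3)] by simp
    moreover have "br a (j x) = br a (c u) + br a (k w)"
      unfolding x linear_add[OF linj] using j_m[OF x(2)] j_perp[OF x(3)] by (simp add: br_simps)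
    moreover have "br a (c u) \<in> h" using mm'[OF am l_m[OF c(2)]] .
    ultimately show ?thesis using subspace_neg[OF subh] by simp
  qed
  define N where "N x y = br x y + j (br (j x) y + br x (j y)) - br (j x) (j y)" for x y
  have N_add: "N (u + w) (u' + w') = N u u' + N u w' + (N w u' + N w w')" for u w u' w'
    by (simp add: N_def br_simps linear_add[OF linj])
  have N_swap: "N x y = - N y x" for x y
  proof -
    have "br (j x) y + br x (j y) = - (br (j y) x + br y (j x))"
      using br_commute[of "j x" y] br_commute[of x "j y"] by simp
    then show ?thesis
      using br_commute[of x y] br_commute[of "j x" "j y"] by (simp only: N_def linear_neg[OF linj]) simp
  qed
  have N_mm: "N u u' \<in> h" if "u \<in> m" "u' \<in> m" for u u'
  proof -
    have "br (j u) u' + br u (j u') \<in> h"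
      using that mm' l_m c(2) subspace_add[OF subh] by (simp add: j_m)
    moreover have "br (j u) (j u') \<in> h" using that mm' l_m c(2) by (simp add: j_m)
    ultimately show ?thesis using mm'[OF that] j_h subh by (simp add: N_def subspace_diff)
  qed
  have N_mp: "N u w = 0" if u: "u \<in> m" and w: "w \<in> perp m" for u w
  proof -
    have cu: "c u \<in> m" using l_m c(2) by blast
    have "N u w = br u w + (k (br (c u) w) + k (br u (k w))) - br (c u) (k w)"
      using u w cu m_perp k(3) by (simp add: N_def j_m j_perp linear_add[OF linj])
    then show ?thesis using k(5)[OF cu w] k(5)[OF u k(3)] k(4)[OF w] by (simp add: br_simps)
  qed
  have N_pp: "N w w' = 0" if w: "w \<in> perp m" "w' \<in> perp m" for w w'
  proof -
    have "N w w' = br w w' + j (k (br w w' - br (k w) (k w'))) - br (k w) (k w')"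
      unfolding k(7)[OF w, symmetric] using w by (simp add: N_def j_perp)
    also have "j (k (br w w' - br (k w) (k w'))) = - (br w w' - br (k w) (k w'))"
      using k(4)[OF k(6)[OF w]] j_perp[OF k(3)] by simp
    finally show ?thesis by simp
  qed
  have N: "N x y \<in> h" for x y
  proof -
    obtain u w where x: "x = u + w" "u \<in> m" "w \<in> perp m" using split by blast
    obtain u' w' where y: "y = u' + w'" "u' \<in> m" "w' \<in> perp m" using split by blast
    have "N w u' = 0" using N_swap[of w u'] N_mp[OF y(2) x(3)] by simp
    then show ?thesis
      unfolding x y N_add using N_mm[OF x(2) y(2)] N_mp[OF x(2) y(3)] N_pp[OF x(3) y(3)] by simp
  qed
  define J where "J = qlift h j"
  have J: "J (qproj h x) = qproj h (j x)" for x
    unfolding J_def using subh subspace_0[OF subh]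
    by (intro qlift_qproj) (simp_all add: j_h flip: linear_diff[OF linj])
  have jh: "j x \<in> h" if "x \<in> h" for x using j_h[OF that] subspace_0[OF subh] by simp
  note lift = h linj jh J
  have ics: "invariant_complex_structure br h J"
    by (rule lift_invariant_complex_structure_iff[OF lift, THEN iffD2]) (use jj jinv in blast)+
  moreover have "integrable_structure br h J"
    by (rule lift_integrable_iff[OF lift ics, THEN iffD2]) (use N in \<open>simp_all add: N_def\<close>)
  ultimately show ?thesis by blast
qed

end

section \<open>Integrable complex structures and centralizers\<close>

theorem theorem1p1:
  fixes br :: "'g::real_vector \<Rightarrow> 'g \<Rightarrow> 'g" and h :: "'g set"
  assumes "lie_algebra br"
    and "finite_dimensional TYPE('g)"
    and "\<exists>ip. invariant_inner_product br ip"
    and "lie_subalgebra br h"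
    and "even (dim (UNIV :: 'g set) - dim h)"
  shows "(\<forall>J. invariant_complex_structure br h J \<and> integrable_structure br h J \<longrightarrow>
            (let m = {x \<in> lie_normalizer br h. qcommute h (ad_bar br h x) J} in
               (\<exists>t. abelian_subalgebra br t \<and> m = lie_centralizer br t) \<and>
               derived_subalgebra br m = derived_subalgebra br h \<and>
               h \<subseteq> m))
       \<and> ((\<exists>t. abelian_subalgebra br t \<and>
               derived_subalgebra br (lie_centralizer br t) = derived_subalgebra br h) \<longrightarrow>
            (\<exists>J. invariant_complex_structure br h J \<and> integrable_structure br h J))"
proof -
  obtain ip where ip: "invariant_inner_product br ip" using assms(3) by blast
  interpret lie_algebra br by (rule assms(1))
  interpret inner_space ip
    by unfold_locales (use ip assms(2) in \<open>auto simp: invariant_inner_product_def\<close>)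
  interpret compact_lie_algebra br ip
    by unfold_locales (use ip in \<open>auto simp: invariant_inner_product_def eq_neg_iff_add_eq_0\<close>)
  show ?thesis
  proof (intro conjI allI impI)
    fix J assume "invariant_complex_structure br h J \<and> integrable_structure br h J"
    then show "let m = {x \<in> lie_normalizer br h. qcommute h (ad_bar br h x) J} in
        (\<exists>t. abelian_subalgebra br t \<and> m = lie_centralizer br t) \<and>
        derived_subalgebra br m = derived_subalgebra br h \<and> h \<subseteq> m"
      unfolding Let_def using integrable_stabilizer[OF assms(4) _ _ refl] by blast
  next
    assume "\<exists>t. abelian_subalgebra br t \<and>
        derived_subalgebra br (lie_centralizer br t) = derived_subalgebra br h"
    then obtain t where "abelian_subalgebra br t"
      "derived_subalgebra br (lie_centralizer br t) = derived_subalgebra br h" by blast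
    then obtain z where "h \<subseteq> {x. br x z = 0}" "\<And>x y. br x z = 0 \<Longrightarrow> br y z = 0 \<Longrightarrow> br x y \<in> h"
      using centralizer_containing_subalgebra[OF assms(4)] by blast
    then show "\<exists>J. invariant_complex_structure br h J \<and> integrable_structure br h J"
      by (rule integrable_structure_exists[OF assms(4,5)])
  qed
qed

end
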